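(* Let $n,p\in\mathbb N$, $a\in\mathbb C$, $a\neq 0$, $c\in\mathbb R$, and let an $n\times n$ matrix $A\in\mathbb C^{n\times n}$ be given. Put $v(x)=a\,e^{2\mathrm i c x}I_p$. Assume that $\det\big((A-cI_n)^2+|a|^2I_n\big)\neq 0$. Choose $Q\in\mathbb C^{n\times n}$ with $AQ=QA$ and $Q^2=(A-cI_n)^2+|a|^2I_n$. Let $f_1,f_2\in\mathbb C^{n\times p}$, $f_3=\frac{\mathrm i}{\bar a}(Q+A-cI_n)f_1$, $f_4=-\frac{\mathrm i}{\bar a}(Q-A+cI_n)f_2$, and $$\Lambda_1(x)=e^{-\mathrm i c x}\big(e^{\mathrm i xQ}f_1+e^{-\mathrm i xQ}f_2\big),\qquad \Lambda_2(x)=e^{\mathrm i c x}\big(e^{\mathrm i xQ}f_3+e^{-\mathrm i xQ}f_4\big),\qquad \Pi(x)=\begin{bmatrix}\Lambda_1(x)&\Lambda_2(x)\end{bmatrix}.$$ Let $S(0)\in\mathbb C^{n\times n}$ satisfy $AS(0)-S(0)A^*=\mathrm i\,\Pi(0)\Pi(0)^*$, and put $S(x)=S(0)+\int_0^x\Pi(r)j\Pi(r)^*dr$. Assume additionally that $S(0)>0$. Then the Weyl (and GW-) function of the Dirac system $$y'(x,z)=\big(\mathrm i zj+j\widetilde V(x)\big)y(x,z)\quad\text{on }[0,\infty),\qquad \widetilde V=\begin{bmatrix}0&\widetilde v\\ \widetilde v^*&0\end{bmatrix},\quad \widetilde v(x)=v(x)+2\Lambda_1(x)^*S(x)^{-1}\Lambda_2(x),$$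 has the form $$\varphi(z)=\frac1{\mathrm i a}\Big(\mathcal D+(\mathcal D\mathcal C_1-\mathcal C_2)(\mathcal A^{\times}-zI_n)^{-1}\mathcal B\Big),$$ where $$\mathcal D:=h(z)I_p,\qquad h(z):=z-c-\zeta(z),\qquad \zeta(z)=\sqrt{(z-c)^2+|a|^2},$$ $$\mathcal C_1:=\frac1a\Lambda_1(0)^*S(0)^{-1},\qquad \mathcal C_2:=\mathrm i\Lambda_2(0)^*S(0)^{-1},\qquad \mathcal A^{\times}:=A-\mathcal B\mathcal C_1,\qquad \mathcal B:=\mathrm i a\Lambda_1(0)+h(z)\Lambda_2(0).$$ (The branch of $\zeta(z)$ is chosen so that $\zeta(z)\in\mathbb C_+$ for $z\in\mathbb C_+$.)
   Context: Here $\mathrm i^2=-1$, $j=\begin{bmatrix}I_p&0\\0&-I_p\end{bmatrix}$, $y'=\frac{\partial}{\partial x}y$, $\mathbb C_+$ is the open upper half-plane, $\mathbb C_M=\{z:\Im z>M\}$ for $M>0$, $A^*$ is the conjugate transpose of $A$, and $S>0$ means positive definite. Under the hypotheses $S(x)>0$ for all $x\geq0$, so $\widetilde V$ is well defined on $[0,\infty)$. Let $W(x,z)$ be the $2p\times2p$ fundamental solution of $y'=(\mathrm i zj+j\widetilde V)y$ on $[0,\infty)$ normalised by $W(0,z)=I_{2p}$. Weyl function: a $p\times p$ matrix function $\varphi$ which is holomorphic in $\mathbb C_M$ for some $M>0$ and satisfies $$\int_0^\infty\begin{bmatrix}I_p&\varphi(z)^*\end{bmatrix}W(x,z)^*W(x,z)\begin{bmatrix}I_p\\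 \varphi(z)\end{bmatrix}dx<\infty\qquad(z\in\mathbb C_M).$$ GW-function (generalised Weyl function; $\widetilde V$ locally bounded on $[0,\infty)$): a $p\times p$ matrix function $\varphi$ such that for some $M>0$ it is analytic in $\mathbb C_M$ and, for each $\ell<\infty$, $$\sup_{x\le\ell,\ z\in\mathbb C_M}\left\|e^{-\mathrm i zx}W(x,z)\begin{bmatrix}I_p\\ \varphi(z)\end{bmatrix}\right\|<\infty$$ (with $x\ge 0$). A system with locally bounded $\widetilde V$ has at most one GW-function. *)

theory Defs
  imports "HOL-Complex_Analysis.Complex_Analysis"
begin

section \<open>Complex matrices\<close>

text \<open>
  An \<open>m \<times> n\<close> matrix has type \<open>complex ^ 'n ^ 'm\<close>. On this type the library operations
  \<open>*\<close> and \<open>^\<close> are entrywise; the matrix product is \<open>**\<close>. The index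
  type \<open>'p + 'p\<close> is used for \<open>2p \<times> 2p\<close> matrices in block form.
\<close>

definition smult_mat :: "complex \<Rightarrow> complex ^ 'n ^ 'm \<Rightarrow> complex ^ 'n ^ 'm"  (infixr \<open>*\<^sub>C\<close> 75)
  where "k *\<^sub>C A = (\<chi> i j. k * A $ i $ j)"

definition cadjoint :: "complex ^ 'n ^ 'm \<Rightarrow> complex ^ 'm ^ 'n"
  where "cadjoint A = transpose (map_matrix cnj A)"

definition posdef :: "complex ^ 'n ^ 'n \<Rightarrow> bool"
  where "posdef A \<longleftrightarrow>
    cadjoint A = A \<and> (\<forall>u. u \<noteq> 0 \<longrightarrow> 0 < Re (\<Sum>i\<in>UNIV. cnj (u $ i) * (A *v u) $ i))"

definition mexp :: "complex ^ 'n ^ 'n \<Rightarrow> complex ^ 'n ^ 'n"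
  where "mexp A = (\<Sum>k. (1 / fact k) *\<^sub>R (((**) A ^^ k) (mat 1)))"

definition hcat :: "complex ^ 'p ^ 'm \<Rightarrow> complex ^ 'q ^ 'm \<Rightarrow> complex ^ ('p + 'q) ^ 'm"
  where "hcat A B = (\<chi> i k. case k of Inl l \<Rightarrow> A $ i $ l | Inr l \<Rightarrow> B $ i $ l)"

definition vcat :: "complex ^ 'm ^ 'p \<Rightarrow> complex ^ 'm ^ 'q \<Rightarrow> complex ^ 'm ^ ('p + 'q)"
  where "vcat A B = (\<chi> k. case k of Inl l \<Rightarrow> A $ l | Inr l \<Rightarrow> B $ l)"

definition jmat :: "complex ^ ('p::finite + 'p) ^ ('p::finite + 'p)"
  where "jmat = vcat (hcat (mat 1) 0) (hcat 0 (- mat 1))"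


section \<open>Dirac systems, Weyl functions and GW-functions\<close>

definition half_plane :: "real \<Rightarrow> complex set"
  where "half_plane M = {z. Im z > M}"

definition normalised_fundamental_solution ::
    "(real \<Rightarrow> complex ^ ('p::finite + 'p) ^ ('p::finite + 'p)) \<Rightarrow> complex \<Rightarrow>
     (real \<Rightarrow> complex ^ ('p::finite + 'p) ^ ('p::finite + 'p)) \<Rightarrow> bool"
  where "normalised_fundamental_solution V z Y \<longleftrightarrow>
    Y 0 = mat 1 \<and>
    (\<forall>x\<ge>0. (Y has_vector_derivative (((\<i> * z) *\<^sub>C jmat + jmat ** V x) ** Y x))
              (at x within {0..}))"

text \<open>
  For continuous \<open>V\<close> a normalised fundamental solution exists and is unique on \<open>[0, \<infinity>)\<close>,
  so the choice below only affects the irrelevant values at \<open>x < 0\<close>.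
\<close>

definition dirac_W ::
    "(real \<Rightarrow> complex ^ ('p::finite + 'p) ^ ('p::finite + 'p)) \<Rightarrow> real \<Rightarrow> complex \<Rightarrow> complex ^ ('p::finite + 'p) ^ ('p::finite + 'p)"
  where "dirac_W V x z = (SOME Y. normalised_fundamental_solution V z Y) x"

definition matrix_holomorphic_on :: "(complex \<Rightarrow> complex ^ 'n ^ 'm) \<Rightarrow> complex set \<Rightarrow> bool"
  where "matrix_holomorphic_on F D \<longleftrightarrow> (\<forall>i j. (\<lambda>z. F z $ i $ j) holomorphic_on D)"

definition weyl_function ::
    "(real \<Rightarrow> complex ^ ('p::finite + 'p) ^ ('p::finite + 'p)) \<Rightarrow> (complex \<Rightarrow> complex ^ 'p ^ 'p) \<Rightarrow> bool"
  where "weyl_function V \<phi> \<longleftrightarrow>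
    (\<exists>M>0. matrix_holomorphic_on \<phi> (half_plane M) \<and>
      (\<forall>z\<in>half_plane M.
        set_integrable lborel {0..}
          (\<lambda>x. hcat (mat 1) (cadjoint (\<phi> z)) ** cadjoint (dirac_W V x z)
                 ** dirac_W V x z ** vcat (mat 1) (\<phi> z))))"

text \<open>
  The norm below is the Frobenius norm.
\<close>

definition GW_function ::
    "(real \<Rightarrow> complex ^ ('p::finite + 'p) ^ ('p::finite + 'p)) \<Rightarrow> (complex \<Rightarrow> complex ^ 'p ^ 'p) \<Rightarrow> bool"
  where "GW_function V \<phi> \<longleftrightarrow>
    (\<forall>l. bounded (V ` {0..l})) \<and>
    (\<exists>M>0. matrix_holomorphic_on \<phi> (half_plane M) \<and>
      (\<forall>l. \<exists>K. \<forall>x\<in>{0..l}. \<forall>z\<in>half_plane M.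
        norm (exp (- \<i> * z * of_real x) *\<^sub>C (dirac_W V x z ** vcat (mat 1) (\<phi> z))) \<le> K))"


section \<open>The branch of the square root\<close>

text \<open>
  A value of \<open>sqrt ((z - c)\<^sup>2 + \<bar>a\<bar>\<^sup>2)\<close> in the open upper half-plane exists, for \<open>Im z > 0\<close>,
  exactly when \<open>z\<close> is off the segment from \<open>c\<close> to \<open>c + \<i> \<bar>a\<bar>\<close>; on that segment both roots
  are real. The formula below picks the root in the upper half-plane whenever there is one.
  The values on the segment do not matter for Weyl functions, which live on \<open>Im z > M\<close>.
\<close>

definition zeta_branch :: "complex \<Rightarrow> real \<Rightarrow> complex \<Rightarrow> complex"
  where "zeta_branch a c z = \<i> * csqrt (- ((z - of_real c)\<^sup>2 + of_real ((cmod a)\<^sup>2)))"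

lemma zeta_branch_square:
  "(zeta_branch a c z)\<^sup>2 = (z - of_real c)\<^sup>2 + of_real ((cmod a)\<^sup>2)"
  unfolding zeta_branch_def power_mult_distrib power2_csqrt by simp

lemma zeta_branch_upper:
  assumes "Im z > 0" and "\<not> (Re z = c \<and> Im z \<le> cmod a)"
  shows "Im (zeta_branch a c z) > 0"
proof (rule ccontr)
  define w where "w = (z - of_real c)\<^sup>2 + of_real ((cmod a)\<^sup>2)"
  define s where "s = csqrt (- w)"
  assume "\<not> Im (zeta_branch a c z) > 0"
  moreover have "Re s \<ge> 0"
    using csqrt_principal[of "- w"] unfolding s_def by auto
  ultimately have s0: "Re s = 0"
    unfolding zeta_branch_def s_def w_def by simp
  have sq: "s\<^sup>2 = - w"
    unfolding s_def by simp
  have "Im w = 0"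
    using arg_cong[OF sq, of Im] s0 by (simp add: power2_eq_square)
  moreover have Im_w: "Im w = 2 * (Re z - c) * Im z"
    unfolding w_def by (simp add: Im_power2 del: of_real_power)
  ultimately have Re_z: "Re z = c"
    using assms(1) by simp
  have "Re w = (Im s)\<^sup>2"
    using arg_cong[OF sq, of Re] s0 by (simp add: power2_eq_square)
  moreover have "Re w = (cmod a)\<^sup>2 - (Im z)\<^sup>2"
    unfolding w_def by (simp add: Re_power2 Re_z del: of_real_power)
  ultimately have "(Im z)\<^sup>2 \<le> (cmod a)\<^sup>2"
    using zero_le_power2[of "Im s"] by linarith
  then have "Im z \<le> cmod a"
    by (rule power2_le_imp_le) (rule norm_ge_zero)
  with Re_z show False
    using assms(2) by blast
qed

end

theory Submission
  imports Defs
begin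

text \<open>
  The system is the Darboux transform of the one with potential \<open>v\<close>. If \<open>P' = -iAPj - PjV\<close> and
  \<open>S' = PjP\<^sup>*\<close>, the identity \<open>AS - SA\<^sup>* = iPP\<^sup>*\<close> persists, and
  \<open>w(x,z) = I - iP\<^sup>*S\<^sup>-\<^sup>1(A - z)\<^sup>-\<^sup>1P\<close> intertwines the two systems, so that the new fundamental
  solution is \<open>w(x,z) W0(x,z) w(0,z)\<^sup>-\<^sup>1\<close> with an explicit \<open>W0\<close>. Both \<open>w\<close> and its inverse
  \<open>I + iP\<^sup>*(A\<^sup>* - z)\<^sup>-\<^sup>1S\<^sup>-\<^sup>1P\<close> grow at most like \<open>e^(Kx)\<close> with \<open>K\<close> independent of \<open>z\<close>, because
  \<open>S(x) \<ge> e^(ixA) S(0) e^(-ixA\<^sup>*)\<close>. Hence \<open>W[I; \<phi>]\<close>, with \<open>\<phi>\<close> read off from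
  \<open>w(0,z)[I; h/(ia)]\<close>, is bounded by \<open>C e^((K - Im z)x)\<close>, while \<open>W[0; g]\<close> is at least
  \<open>k |g| e^((Im z - K)x)\<close>. For a second Weyl function \<open>\<psi>\<close> this excludes \<open>\<psi> \<noteq> \<phi>\<close> pointwise; for a
  second GW-function it gives \<open>|\<psi> - \<phi>| \<le> C\<^sub>l e^(-2l Im z)\<close> for all \<open>l\<close>, and a function analytic in
  a half-plane with this decay vanishes by the Phragmen-Lindelof principle.
\<close>

section \<open>Block matrices and the Frobenius norm\<close>

text \<open>The obstacle is that S' = P j P^* is indefinite, so S(0) > 0 does not by itself keep
  S(x) positive. Along solutions of \<eta>' = i A^* \<eta> the identity for AS - SA^* replaces j by
  I + j \<ge> 0; this is what makes S(x) invertible, with an inverse of at most exponential growth.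
  The number h/(ia) comes from the seed: once its oscillation is removed, the coefficient matrix has
  the eigenvalues i\<zeta> and -i\<zeta>, the columns of [I; h/(ia)] span the decaying eigenspace,
  and a block row belonging to -i\<zeta> annihilates them. Applying that row to w^-1 W [0; g]
  isolates the growing part, which gives the lower bound as soon as w(0,z)^-1 is close to I. All
  rates have to be independent of z, since the only gain is Im z. The inequality |h| \<le> |a| gives
  Im \<zeta> \<ge> Im z - |a|, so a half-plane that lies high enough beats every fixed rate. There
  the resolvents exist by size alone, also the one in \<phi>, whose matrix varies with z through h
  but stays bounded.\<close>

lemma smult_mat_nth [simp]: "(k *\<^sub>C A) $ i $ j = k * A $ i $ j"
  by (simp add: smult_mat_def)

lemma cadjoint_nth [simp]: "cadjoint A $ i $ j = cnj (A $ j $ i)"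
  by (simp add: cadjoint_def transpose_def)

lemma hcat_nth [simp]: "hcat A B $ i $ Inl l = A $ i $ l" "hcat A B $ i $ Inr r = B $ i $ r"
  by (simp_all add: hcat_def)

lemma vcat_nth [simp]: "vcat A B $ Inl l = A $ l" "vcat A B $ Inr r = B $ r"
  by (simp_all add: vcat_def)

lemma mat_mult_nth: "(A ** B) $ i $ j = (\<Sum>k\<in>UNIV. A $ i $ k * B $ k $ j)"
  by (simp add: matrix_matrix_mult_def)

lemma all_sum_type: "(\<forall>k::'a + 'b. R k) \<longleftrightarrow> (\<forall>l. R (Inl l)) \<and> (\<forall>r. R (Inr r))"
  by (metis sum.exhaust)

lemma sum_sum_type:
  fixes f :: "'a::finite + 'b::finite \<Rightarrow> 'c::comm_monoid_add"
  shows "(\<Sum>k\<in>UNIV. f k) = (\<Sum>l\<in>UNIV. f (Inl l)) + (\<Sum>r\<in>UNIV. f (Inr r))"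
  unfolding UNIV_Plus_UNIV[symmetric] by (subst sum.Plus) auto

lemma smult_mat_mult_left [simp]: "(k *\<^sub>C A) ** B = k *\<^sub>C (A ** B)"
  by (simp add: vec_eq_iff mat_mult_nth sum_distrib_left mult.assoc)

lemma smult_mat_mult_right [simp]: "A ** (k *\<^sub>C B) = k *\<^sub>C (A ** B)"
  by (simp add: vec_eq_iff mat_mult_nth sum_distrib_left mult.left_commute)

lemma smult_mat_smult [simp]: "k *\<^sub>C l *\<^sub>C A = (k * l) *\<^sub>C A"
  by (simp add: vec_eq_iff mult.assoc)

lemma smult_mat_one [simp]: "1 *\<^sub>C A = A"
  and smult_mat_zero [simp]: "0 *\<^sub>C A = 0" "k *\<^sub>C 0 = 0"
  and smult_mat_minus [simp]: "(- k) *\<^sub>C A = - (k *\<^sub>C A)" "k *\<^sub>C (- A) = - (k *\<^sub>C A)"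
  by (simp_all add: vec_eq_iff)

lemma smult_mat_add: "k *\<^sub>C (A + B) = k *\<^sub>C A + k *\<^sub>C B" "(k + l) *\<^sub>C A = k *\<^sub>C A + l *\<^sub>C A"
  and smult_mat_diff: "k *\<^sub>C (A - B) = k *\<^sub>C A - k *\<^sub>C B" "(k - l) *\<^sub>C A = k *\<^sub>C A - l *\<^sub>C A"
  by (simp_all add: vec_eq_iff algebra_simps)

text \<open>Arithmetic normalisation collects equal summands into \<open>2 * M\<close>, where
  \<open>2\<close> is the matrix with all entries 2 and the product is entrywise; this turns it back
  into a scalar multiple.\<close>

lemma two_mult: "2 * M = 2 *\<^sub>C M"
  by (simp add: vec_eq_iff)

lemma mat_mult_add: "A ** (B + C) = A ** B + A ** C" "(D + E) ** B = D ** B + E ** B"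
  and mat_mult_diff: "A ** (B - C) = A ** B - A ** C" "(D - E) ** B = D ** B - E ** B"
  and mat_mult_minus [simp]: "A ** (- B) = - (A ** B)" "(- A) ** B = - (A ** B)"
  for A D E :: "complex ^ 'n ^ 'm" and B C :: "complex ^ 'p ^ 'n"
  by (simp_all add: vec_eq_iff mat_mult_nth algebra_simps sum.distrib sum_subtractf sum_negf)

lemma mat_mult_zero [simp]: "A ** 0 = 0" "0 ** B = 0"
  for A :: "complex ^ 'n ^ 'm" and B :: "complex ^ 'p ^ 'n"
  by (simp_all add: vec_eq_iff mat_mult_nth)

lemmas mat_mult_assoc = matrix_mul_assoc[symmetric]

lemmas mat_distribs = mat_mult_add mat_mult_diff smult_mat_add smult_mat_diff mat_mult_assoc

lemma scaleR_smult_mat: "r *\<^sub>R A = complex_of_real r *\<^sub>C A" for A :: "complex ^ 'n ^ 'm"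
  by (simp add: vec_eq_iff vector_scaleR_component scaleR_conv_of_real[where 'a = complex])

lemma cadjoint_mult: "cadjoint (A ** B) = cadjoint B ** cadjoint A"
  by (simp add: vec_eq_iff mat_mult_nth mult.commute)

lemma cadjoint_cadjoint [simp]: "cadjoint (cadjoint A) = A"
  and cadjoint_add: "cadjoint (A + B) = cadjoint A + cadjoint B"
  and cadjoint_diff: "cadjoint (A - B) = cadjoint A - cadjoint B"
  and cadjoint_minus: "cadjoint (- A) = - cadjoint A"
  and cadjoint_smult: "cadjoint (k *\<^sub>C A) = cnj k *\<^sub>C cadjoint A"
  and cadjoint_zero [simp]: "cadjoint 0 = 0"
  by (simp_all add: vec_eq_iff)

lemma cadjoint_mat_one [simp]: "cadjoint (mat 1) = mat 1"
  by (simp add: vec_eq_iff mat_def)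

lemma cadjoint_hcat: "cadjoint (hcat A B) = vcat (cadjoint A) (cadjoint B)"
  and cadjoint_vcat: "cadjoint (vcat A' B') = hcat (cadjoint A') (cadjoint B')"
  by (simp_all add: vec_eq_iff all_sum_type)

lemma hcat_mult_vcat: "hcat A B ** vcat C D = A ** C + B ** D"
  by (simp add: vec_eq_iff mat_mult_nth sum_sum_type)

lemma mult_hcat: "A ** hcat B C = hcat (A ** B) (A ** C)"
  and vcat_mult: "vcat A' B' ** C' = vcat (A' ** C') (B' ** C')"
  by (simp_all add: vec_eq_iff mat_mult_nth all_sum_type)

lemma hcat_add: "hcat A B + hcat C D = hcat (A + C) (B + D)"
  and vcat_add: "vcat A' B' + vcat C' D' = vcat (A' + C') (B' + D')"
  and hcat_diff: "hcat A B - hcat C D = hcat (A - C) (B - D)"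
  and vcat_diff: "vcat A' B' - vcat C' D' = vcat (A' - C') (B' - D')"
  and smult_hcat: "k *\<^sub>C hcat A B = hcat (k *\<^sub>C A) (k *\<^sub>C B)"
  and smult_vcat: "k *\<^sub>C vcat A' B' = vcat (k *\<^sub>C A') (k *\<^sub>C B')"
  and minus_hcat: "- hcat A B = hcat (- A) (- B)"
  and minus_vcat: "- vcat A' B' = vcat (- A') (- B')"
  by (simp_all add: vec_eq_iff all_sum_type)

lemma hcat_vcat: "hcat (vcat A B) (vcat C D) = vcat (hcat A C) (hcat B D)"
  by (simp add: vec_eq_iff all_sum_type)

lemmas block_simps = hcat_vcat hcat_mult_vcat mult_hcat vcat_mult hcat_add vcat_add hcat_diff vcat_diff
  smult_hcat smult_vcat minus_hcat minus_vcat cadjoint_hcat cadjoint_vcat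

lemma mat_one_block: "(mat 1 :: complex ^ ('p::finite + 'p) ^ ('p + 'p)) = vcat (hcat (mat 1) 0) (hcat 0 (mat 1))"
  by (simp add: vec_eq_iff all_sum_type mat_def)

lemma jmat_jmat [simp]: "jmat ** jmat = mat 1"
  unfolding mat_one_block jmat_def by (simp add: block_simps)

lemma cadjoint_jmat [simp]: "cadjoint jmat = jmat"
  unfolding jmat_def by (simp add: block_simps cadjoint_minus)

lemma norm_smult_mat [simp]: "norm (k *\<^sub>C A) = cmod k * norm A"
  by (simp add: norm_vec_def norm_mult L2_set_right_distrib)

lemma norm_mat_sq: "(norm A)\<^sup>2 = (\<Sum>i\<in>UNIV. \<Sum>j\<in>UNIV. (cmod (A $ i $ j))\<^sup>2)"
  for A :: "complex ^ 'n ^ 'm"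
  by (simp add: norm_vec_def L2_set_def sum_nonneg)

lemma norm_mat_nth: "cmod (A $ i $ j) \<le> norm A" for A :: "complex ^ 'n ^ 'm"
  using Finite_Cartesian_Product.norm_nth_le[of "A $ i" j] Finite_Cartesian_Product.norm_nth_le[of A i] by linarith

lemma norm_cadjoint [simp]: "norm (cadjoint A) = norm A"
proof -
  have "(norm (cadjoint A))\<^sup>2 = (norm A)\<^sup>2"
    unfolding norm_mat_sq by (subst sum.swap) simp
  then show ?thesis by simp
qed

text \<open>Cauchy-Schwarz for each entry, row of \<open>A\<close> against column of
  \<open>B\<close>. The library norm on nested vectors is the Frobenius norm, so all estimates are
  made in it, at the price of factors \<open>norm (mat 1)\<close>.\<close>

lemma norm_mat_mult: "norm (A ** B) \<le> norm A * norm B"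
  for A :: "complex ^ 'n ^ 'm" and B :: "complex ^ 'p ^ 'n"
proof (rule power2_le_imp_le)
  have "(cmod ((A ** B) $ i $ j))\<^sup>2 \<le> (\<Sum>k\<in>UNIV. (cmod (A $ i $ k))\<^sup>2) * (\<Sum>k\<in>UNIV. (cmod (B $ k $ j))\<^sup>2)"
    for i j
  proof -
    have "cmod ((A ** B) $ i $ j) \<le> (\<Sum>k\<in>UNIV. cmod (A $ i $ k) * cmod (B $ k $ j))"
      unfolding mat_mult_nth by (rule order_trans[OF norm_sum]) (simp add: norm_mult)
    then have "(cmod ((A ** B) $ i $ j))\<^sup>2 \<le> (\<Sum>k\<in>UNIV. cmod (A $ i $ k) * cmod (B $ k $ j))\<^sup>2"
      by (intro power_mono) auto
    also have "\<dots> \<le> (\<Sum>k\<in>UNIV. (cmod (A $ i $ k))\<^sup>2) * (\<Sum>k\<in>UNIV. (cmod (B $ k $ j))\<^sup>2)"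
      by (rule Cauchy_Schwarz_ineq_sum)
    finally show ?thesis .
  qed
  then have "(norm (A ** B))\<^sup>2 \<le> (\<Sum>i\<in>UNIV. \<Sum>j\<in>UNIV.
      (\<Sum>k\<in>UNIV. (cmod (A $ i $ k))\<^sup>2) * (\<Sum>k\<in>UNIV. (cmod (B $ k $ j))\<^sup>2))"
    unfolding norm_mat_sq by (intro sum_mono)
  also have "\<dots> = (\<Sum>i\<in>UNIV. \<Sum>k\<in>UNIV. (cmod (A $ i $ k))\<^sup>2) * (\<Sum>j\<in>UNIV. \<Sum>k\<in>UNIV. (cmod (B $ k $ j))\<^sup>2)"
    by (simp add: sum_product)
  also have "(\<Sum>j\<in>UNIV. \<Sum>k\<in>UNIV. (cmod (B $ k $ j))\<^sup>2) = (norm B)\<^sup>2"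
    unfolding norm_mat_sq by (rule sum.swap)
  finally show "(norm (A ** B))\<^sup>2 \<le> (norm A * norm B)\<^sup>2"
    by (simp add: norm_mat_sq[symmetric] power_mult_distrib)
qed simp

lemma norm_mat_mult_le:
  fixes A :: "complex ^ 'n ^ 'm" and B :: "complex ^ 'p ^ 'n"
  assumes "norm A \<le> a" "norm B \<le> b"
  shows "norm (A ** B) \<le> a * b"
  using norm_mat_mult[of A B] assms
  by (meson mult_mono norm_ge_zero order_trans)

lemma norm_hcat: "norm (hcat A B) \<le> norm A + norm B"
  and norm_vcat: "norm (vcat A' B') \<le> norm A' + norm B'"
proof -
  have "(norm (hcat A B))\<^sup>2 = (norm A)\<^sup>2 + (norm B)\<^sup>2"
    and "(norm (vcat A' B'))\<^sup>2 = (norm A')\<^sup>2 + (norm B')\<^sup>2"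
    unfolding norm_mat_sq by (simp_all add: sum_sum_type sum.distrib)
  then show "norm (hcat A B) \<le> norm A + norm B" "norm (vcat A' B') \<le> norm A' + norm B'"
    by (smt (verit) norm_ge_zero real_sqrt_abs real_sqrt_le_iff sqrt_sum_squares_le_sum abs_norm_cancel)+
qed

lemma bounded_bilinear_mat_mult:
  "bounded_bilinear ((**) :: complex ^ 'n ^ 'm \<Rightarrow> complex ^ 'p ^ 'n \<Rightarrow> complex ^ 'p ^ 'm)"
proof
  show "\<exists>K. \<forall>(a :: complex ^ 'n ^ 'm) (b :: complex ^ 'p ^ 'n). norm (a ** b) \<le> norm a * norm b * K"
    using norm_mat_mult by (metis mult.right_neutral)
qed (simp_all add: mat_mult_add scaleR_smult_mat)

lemma bounded_bilinear_smult_mat: "bounded_bilinear ((*\<^sub>C) :: complex \<Rightarrow> complex ^ 'n ^ 'm \<Rightarrow> _)"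
proof
  show "\<exists>K. \<forall>a (b :: complex ^ 'n ^ 'm). norm (a *\<^sub>C b) \<le> norm a * norm b * K"
    by (metis mult.right_neutral norm_smult_mat order_refl)
qed (simp_all add: smult_mat_add scaleR_smult_mat scaleR_conv_of_real[where 'a = complex] mult.commute)

lemma bounded_linear_cadjoint: "bounded_linear (cadjoint :: complex ^ 'n ^ 'm \<Rightarrow> _)"
proof
  show "\<exists>K. \<forall>x :: complex ^ 'n ^ 'm. norm (cadjoint x) \<le> norm x * K"
    by (metis mult.right_neutral norm_cadjoint order_refl)
qed (simp_all add: cadjoint_add scaleR_smult_mat cadjoint_smult)

lemmas mat_mult_has_vector_derivative = bounded_bilinear.has_vector_derivative[OF bounded_bilinear_mat_mult]
lemmas smult_mat_has_vector_derivative = bounded_bilinear.has_vector_derivative[OF bounded_bilinear_smult_mat]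
lemmas cadjoint_has_vector_derivative = bounded_linear.has_vector_derivative[OF bounded_linear_cadjoint]

text \<open>The library inner product on matrices is the real part of the trace of X^* Y, so left
  multiplication by \<open>A\<close> has the expected adjoint. Positivity can thus be treated on
  square matrices in place of vectors.\<close>

lemma inner_mat_cadjoint: "inner (A ** X) Y = inner X (cadjoint A ** Y)"
  for A :: "complex ^ 'n ^ 'm" and X :: "complex ^ 'p ^ 'n"
proof -
  have e: "inner X Y = Re (\<Sum>i\<in>UNIV. \<Sum>j\<in>UNIV. cnj (X $ i $ j) * Y $ i $ j)" for X Y :: "complex ^ 'a ^ 'b"
    by (simp add: inner_vec_def inner_complex_def)
  have "(\<Sum>i\<in>UNIV. \<Sum>j\<in>UNIV. cnj ((A ** X) $ i $ j) * Y $ i $ j) =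
        (\<Sum>i\<in>UNIV. \<Sum>j\<in>UNIV. \<Sum>k\<in>UNIV. cnj (A $ i $ k) * cnj (X $ k $ j) * Y $ i $ j)"
    by (simp add: mat_mult_nth sum_distrib_right)
  also have "\<dots> = (\<Sum>j\<in>UNIV. \<Sum>i\<in>UNIV. \<Sum>k\<in>UNIV. cnj (A $ i $ k) * cnj (X $ k $ j) * Y $ i $ j)"
    by (rule sum.swap)
  also have "\<dots> = (\<Sum>j\<in>UNIV. \<Sum>k\<in>UNIV. \<Sum>i\<in>UNIV. cnj (A $ i $ k) * cnj (X $ k $ j) * Y $ i $ j)"
    by (intro sum.cong refl, rule sum.swap)
  also have "\<dots> = (\<Sum>k\<in>UNIV. \<Sum>j\<in>UNIV. \<Sum>i\<in>UNIV. cnj (A $ i $ k) * cnj (X $ k $ j) * Y $ i $ j)"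
    by (rule sum.swap)
  also have "\<dots> = (\<Sum>k\<in>UNIV. \<Sum>j\<in>UNIV. cnj (X $ k $ j) * (cadjoint A ** Y) $ k $ j)"
    by (simp add: mat_mult_nth sum_distrib_left mult_ac)
  finally show ?thesis by (simp only: e)
qed

text \<open>The lower bound makes the kernel trivial; applied to the inverse itself it bounds the
  norm of the inverse.\<close>

lemma mat_inv_of_lower_bound:
  fixes M :: "complex ^ 'n ^ 'n"
  assumes "s > 0" and lower: "\<And>Y :: complex ^ 'n ^ 'n. s * norm Y \<le> norm (M ** Y)"
  shows "M ** matrix_inv M = mat 1" "matrix_inv M ** M = mat 1"
    and "norm (matrix_inv M) \<le> norm (mat 1 :: complex ^ 'n ^ 'n) / s"
proof -
  have "v = 0" if "M *v v = 0" for v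
  proof -
    \<comment> \<open>A vector becomes a test matrix by repeating it in every column.\<close>
    define Y :: "complex ^ 'n ^ 'n" where "Y = (\<chi> i j. v $ i)"
    have "M ** Y = 0"
      using that by (simp add: vec_eq_iff mat_mult_nth matrix_vector_mult_def Y_def)
    then have "Y = 0" using lower[of Y] \<open>s > 0\<close> by (simp add: mult_le_0_iff)
    then show ?thesis by (simp add: Y_def vec_eq_iff)
  qed
  then have "invertible M"
    using matrix_left_invertible_ker[of M] invertible_left_inverse by blast
  then show inv: "M ** matrix_inv M = mat 1" "matrix_inv M ** M = mat 1"
    unfolding matrix_inv_def invertible_def by (metis (mono_tags, lifting) someI_ex)+
  show "norm (matrix_inv M) \<le> norm (mat 1 :: complex ^ 'n ^ 'n) / s"
    using lower[of "matrix_inv M"] \<open>s > 0\<close> by (simp add: inv(1) field_simps)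
qed

text \<open>Outside the disc of radius \<open>norm M\<close> the term \<open>z\<close> dominates;
  \<open>s\<close> measures the distance to that disc. This one estimate supplies every resolvent
  below.\<close>

lemma mat_inv_diff_scalar:
  fixes M :: "complex ^ 'n ^ 'n"
  assumes "norm M + s \<le> cmod z" "s > 0"
  shows "(M - z *\<^sub>C mat 1) ** matrix_inv (M - z *\<^sub>C mat 1) = mat 1"
    and "matrix_inv (M - z *\<^sub>C mat 1) ** (M - z *\<^sub>C mat 1) = mat 1"
    and "norm (matrix_inv (M - z *\<^sub>C mat 1)) \<le> norm (mat 1 :: complex ^ 'n ^ 'n) / s"
proof -
  have "s * norm Y \<le> norm ((M - z *\<^sub>C mat 1) ** Y)" for Y :: "complex ^ 'n ^ 'n"
  proof -
    have "cmod z * norm Y - norm M * norm Y \<le> norm (z *\<^sub>C Y) - norm (M ** Y)"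
      using norm_mat_mult[of M Y] by simp
    also have "\<dots> \<le> norm (M ** Y - z *\<^sub>C Y)"
      by (metis norm_minus_commute norm_triangle_ineq2)
    finally have "(cmod z - norm M) * norm Y \<le> norm ((M - z *\<^sub>C mat 1) ** Y)"
      by (simp add: mat_distribs algebra_simps)
    moreover have "s * norm Y \<le> (cmod z - norm M) * norm Y"
      using assms by (intro mult_right_mono) auto
    ultimately show ?thesis by linarith
  qed
  from mat_inv_of_lower_bound[OF assms(2) this]
  show "(M - z *\<^sub>C mat 1) ** matrix_inv (M - z *\<^sub>C mat 1) = mat 1"
    and "matrix_inv (M - z *\<^sub>C mat 1) ** (M - z *\<^sub>C mat 1) = mat 1"
    and "norm (matrix_inv (M - z *\<^sub>C mat 1)) \<le> norm (mat 1 :: complex ^ 'n ^ 'n) / s"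
    by auto
qed

section \<open>Matrix-valued functions of a real variable\<close>

lemma has_real_derivative_nonneg_imp_le:
  fixes g :: "real \<Rightarrow> real"
  assumes g: "\<And>x. \<lbrakk>0 \<le> x; x \<le> l\<rbrakk> \<Longrightarrow> (g has_real_derivative g' x) (at x within {0..l})"
    and nonneg: "\<And>x. \<lbrakk>0 \<le> x; x \<le> l\<rbrakk> \<Longrightarrow> 0 \<le> g' x" and "0 \<le> l"
  shows "g 0 \<le> g l"
proof (rule DERIV_nonneg_imp_increasing_open[of 0 l g])
  show "continuous_on {0..l} g"
    by (rule DERIV_continuous_on) (use g in auto)
  show "\<exists>y. (g has_real_derivative y) (at x) \<and> 0 \<le> y" if "0 < x" "x < l" for x
    using g[of x] nonneg[of x] that by (auto simp: at_within_Icc_at)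
qed fact

text \<open>Turns a derivative into a plain limit, so that derivatives can be taken entrywise and
  products of limits can be used for the derivative of an inverse.\<close>

lemma has_vector_derivative_iff_quotient:
  fixes f :: "real \<Rightarrow> 'a::real_normed_vector"
  shows "(f has_vector_derivative f') (at x within T) \<longleftrightarrow>
    ((\<lambda>y. (1 / (y - x)) *\<^sub>R (f y - f x)) \<longlongrightarrow> f') (at x within T)"
proof -
  let ?q = "\<lambda>y. (1 / norm (y - x)) *\<^sub>R (f y - (f x + (y - x) *\<^sub>R f'))"
  have "norm ((1 / norm (y - x)) *\<^sub>R (f y - (f x + (y - x) *\<^sub>R f'))) = norm ((1 / (y - x)) *\<^sub>R (f y - f x) - f')"
    if "y \<noteq> x" for y
  proof -
    have "f y - (f x + (y - x) *\<^sub>R f') = (y - x) *\<^sub>R ((1 / (y - x)) *\<^sub>R (f y - f x) - f')"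
      using that by (simp add: algebra_simps)
    then show ?thesis using that by simp
  qed
  then have "((\<lambda>y. norm (?q y)) \<longlongrightarrow> 0) (at x within T) \<longleftrightarrow>
      ((\<lambda>y. norm ((1 / (y - x)) *\<^sub>R (f y - f x) - f')) \<longlongrightarrow> 0) (at x within T)"
    by (intro tendsto_cong) (auto simp: eventually_at_filter)
  then have "(?q \<longlongrightarrow> 0) (at x within T) \<longleftrightarrow>
      ((\<lambda>y. (1 / (y - x)) *\<^sub>R (f y - f x)) \<longlongrightarrow> f') (at x within T)"
    unfolding tendsto_norm_zero_iff by (simp only: LIM_zero_iff)
  then show ?thesis
    unfolding has_vector_derivative_def has_derivative_within
    by (simp add: bounded_linear_scaleR_left)
qed

text \<open>The weighted square e^(-2Kx) |D|^2 has a nonpositive derivative by Cauchy-Schwarz. It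
  serves for growth bounds and, with \<open>D 0 = 0\<close>, for uniqueness.\<close>

lemma gronwall_norm:
  fixes D :: "real \<Rightarrow> 'a::real_inner"
  assumes D: "\<And>x. \<lbrakk>0 \<le> x; x \<le> l\<rbrakk> \<Longrightarrow> (D has_vector_derivative D' x) (at x within {0..l})"
    and bound: "\<And>x. \<lbrakk>0 \<le> x; x \<le> l\<rbrakk> \<Longrightarrow> norm (D' x) \<le> K * norm (D x)"
    and "0 \<le> l"
  shows "norm (D l) \<le> norm (D 0) * exp (K * l)"
proof -
  define g where "g x = exp (- 2 * K * x) * inner (D x) (D x)" for x
  define g' where "g' x = exp (- 2 * K * x) * (2 * inner (D x) (D' x) - 2 * K * inner (D x) (D x))" for x
  have "((\<lambda>x. inner (D x) (D x)) has_vector_derivative 2 * inner (D x) (D' x)) (at x within {0..l})"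
    if "0 \<le> x" "x \<le> l" for x
    using bounded_bilinear.has_vector_derivative[OF bounded_bilinear_inner D[OF that] D[OF that]]
    by (simp add: inner_commute)
  then have g: "(g has_real_derivative g' x) (at x within {0..l})" if "0 \<le> x" "x \<le> l" for x
    unfolding g_def g'_def using that
    by (auto intro!: derivative_eq_intros simp: has_real_derivative_iff_has_vector_derivative[symmetric] algebra_simps)
  have nonpos: "g' x \<le> 0" if "0 \<le> x" "x \<le> l" for x
  proof -
    have "inner (D x) (D' x) \<le> norm (D x) * norm (D' x)"
      by (rule norm_cauchy_schwarz)
    also have "\<dots> \<le> norm (D x) * (K * norm (D x))"
      using bound[OF that] by (intro mult_left_mono) auto
    also have "\<dots> = K * inner (D x) (D x)"
      by (simp add: power2_norm_eq_inner[symmetric] power2_eq_square)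
    finally show ?thesis by (simp add: g'_def mult_nonneg_nonpos)
  qed
  have "- g 0 \<le> - g l"
    by (rule has_real_derivative_nonneg_imp_le[of l "\<lambda>x. - g x" "\<lambda>x. - g' x"])
      (use nonpos \<open>0 \<le> l\<close> in \<open>auto intro!: DERIV_minus g\<close>)
  then have "(norm (D l))\<^sup>2 \<le> (norm (D 0) * exp (K * l))\<^sup>2"
    by (simp add: g_def power2_norm_eq_inner[symmetric] power_mult_distrib exp_minus field_simps
        exp_of_nat_mult[symmetric] flip: exp_double)
  then show ?thesis
    by (rule power2_le_imp_le) simp
qed

text \<open>Each entry of \<open>mexp (t M)\<close> is a scalar power series in \<open>t\<close>,
  which makes termwise differentiation of complex power series applicable.\<close>

lemma mexp_nth_sums:
  fixes M :: "complex ^ 'n ^ 'n" and p :: "nat \<Rightarrow> complex ^ 'n ^ 'n"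
  defines "p \<equiv> \<lambda>k. ((**) M ^^ k) (mat 1)"
  shows "norm (p k) \<le> norm M ^ k * norm (mat 1 :: complex ^ 'n ^ 'n)"
    and "summable (\<lambda>k. p k $ i $ j / fact k * t ^ k)"
    and "mexp (t *\<^sub>C M) $ i $ j = (\<Sum>k. p k $ i $ j / fact k * t ^ k)"
proof -
  show pk: "norm (p k) \<le> norm M ^ k * norm (mat 1 :: complex ^ 'n ^ 'n)" for k
  proof (induction k)
    case (Suc k)
    have "norm (p (Suc k)) \<le> norm M * norm (p k)"
      unfolding p_def by (simp add: norm_mat_mult)
    also have "\<dots> \<le> norm M * (norm M ^ k * norm (mat 1 :: complex ^ 'n ^ 'n))"
      using Suc by (intro mult_left_mono) auto
    finally show ?case by (simp add: mult.assoc)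
  qed (simp add: p_def)
  have sm: "summable (\<lambda>k. norm (mat 1 :: complex ^ 'n ^ 'n) * ((cmod t * norm M) ^ k / fact k))" for t
    by (intro summable_mult) (use summable_exp[of "cmod t * norm M"] in \<open>simp add: field_simps\<close>)
  have le: "cmod (p k $ i $ j / fact k * t ^ k) \<le> norm (mat 1 :: complex ^ 'n ^ 'n) * ((cmod t * norm M) ^ k / fact k)"
    for k t i j
  proof -
    have "cmod (p k $ i $ j) \<le> norm M ^ k * norm (mat 1 :: complex ^ 'n ^ 'n)"
      using norm_mat_nth pk order_trans by blast
    then have "cmod (p k $ i $ j) * (cmod t ^ k / fact k) \<le> norm M ^ k * norm (mat 1 :: complex ^ 'n ^ 'n) * (cmod t ^ k / fact k)"
      by (intro mult_right_mono) auto
    then show ?thesis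
      by (simp add: norm_mult norm_divide norm_power power_mult_distrib mult_ac)
  qed
  show sum: "summable (\<lambda>k. p k $ i $ j / fact k * t ^ k)" for i j t
    by (rule summable_comparison_test'[OF sm]) (rule le)
  have "((**) (t *\<^sub>C M) ^^ k) (mat 1) = t ^ k *\<^sub>C p k" for k
    by (induction k) (simp_all add: p_def mult_ac)
  then have "(1 / fact k) *\<^sub>R (((**) (t *\<^sub>C M) ^^ k) (mat 1)) = (\<chi> i j. p k $ i $ j / fact k * t ^ k)" for k
    by (simp add: vec_eq_iff scaleR_conv_of_real[where 'a = complex] field_simps)
  then have e: "mexp (t *\<^sub>C M) = (\<Sum>k. (\<chi> i j. p k $ i $ j / fact k * t ^ k))"
    by (simp add: mexp_def)
  have "(\<lambda>n. \<Sum>k<n. (\<chi> i j. p k $ i $ j / fact k * t ^ k)) \<longlonglongrightarrow> (\<chi> i j. \<Sum>k. p k $ i $ j / fact k * t ^ k)"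
    by (intro vec_tendstoI) (use summable_LIMSEQ[OF sum] in \<open>simp\<close>)
  then have "(\<lambda>k. (\<chi> i j. p k $ i $ j / fact k * t ^ k)) sums (\<chi> i j. \<Sum>k. p k $ i $ j / fact k * t ^ k)"
    by (simp add: sums_def)
  then show "mexp (t *\<^sub>C M) $ i $ j = (\<Sum>k. p k $ i $ j / fact k * t ^ k)"
    unfolding e by (simp add: sums_iff)
qed

lemma has_vector_derivative_mat:
  fixes F :: "real \<Rightarrow> complex ^ 'n ^ 'm"
  assumes "\<And>i j. ((\<lambda>x. F x $ i $ j) has_vector_derivative F' $ i $ j) (at x within T)"
  shows "(F has_vector_derivative F') (at x within T)"
  using assms unfolding has_vector_derivative_iff_quotient
  by (intro vec_tendstoI) simp

lemma mexp_zero: "mexp (0 :: complex ^ 'n ^ 'n) = mat 1"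
proof -
  have "mexp (0 *\<^sub>C (0 :: complex ^ 'n ^ 'n)) $ i $ j = mat 1 $ i $ j" for i j
    unfolding mexp_nth_sums(3) powser_zero by simp
  then show ?thesis by (simp add: vec_eq_iff)
qed

text \<open>The shift \<open>m\<close> allows an exponential normalised at a point other than 0, as
  in the comparison solution of \<open>S_lower_bound\<close>.\<close>

lemma mexp_has_vector_derivative:
  fixes M :: "complex ^ 'n ^ 'n"
  shows "((\<lambda>x. mexp ((k * of_real x + m) *\<^sub>C M)) has_vector_derivative
    k *\<^sub>C (M ** mexp ((k * of_real x + m) *\<^sub>C M))) (at x within T)"
proof (rule has_vector_derivative_mat)
  fix i j
  define p :: "nat \<Rightarrow> complex ^ 'n ^ 'n" where "p l = ((**) M ^^ l) (mat 1)" for l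
  note ps = mexp_nth_sums[where M = M, folded p_def]
  define c where "c i l = p l $ i $ j / fact l" for i l
  have c: "summable (\<lambda>l. c i l * t ^ l)" for i t
    unfolding c_def by (rule ps)
  have diffs: "diffs (c i) l = (\<Sum>m\<in>UNIV. M $ i $ m * c m l)" for l
  proof -
    \<comment> \<open>The formal derivative shifts the index, and the shifted power of
      \<open>M\<close> is \<open>M\<close> times the old one.\<close>
    have "diffs (c i) l = p (Suc l) $ i $ j / fact l"
      by (simp add: diffs_def c_def field_simps del: of_nat_Suc)
    also have "p (Suc l) = M ** p l" by (simp add: p_def)
    also have "(M ** p l) $ i $ j / fact l = (\<Sum>m\<in>UNIV. M $ i $ m * c m l)"
      by (simp add: mat_mult_nth c_def sum_divide_distrib)
    finally show ?thesis .
  qed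
  have "(M ** mexp (t *\<^sub>C M)) $ i $ j = (\<Sum>l. diffs (c i) l * t ^ l)" for t
  proof -
    have "(\<Sum>l. diffs (c i) l * t ^ l) = (\<Sum>l. \<Sum>m\<in>UNIV. M $ i $ m * (c m l * t ^ l))"
      by (simp add: diffs sum_distrib_right mult.assoc)
    also have "\<dots> = (\<Sum>m\<in>UNIV. \<Sum>l. M $ i $ m * (c m l * t ^ l))"
      by (intro suminf_sum summable_mult c)
    also have "\<dots> = (\<Sum>m\<in>UNIV. M $ i $ m * (\<Sum>l. c m l * t ^ l))"
      by (simp add: suminf_mult c)
    finally show ?thesis by (simp add: mat_mult_nth ps c_def)
  qed
  moreover have "((\<lambda>t. \<Sum>l. c i l * t ^ l) has_field_derivative (\<Sum>l. diffs (c i) l * t ^ l)) (at t)" for t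
    by (rule termdiffs_strong_converges_everywhere) (rule c)
  ultimately have d: "((\<lambda>t. mexp (t *\<^sub>C M) $ i $ j) has_field_derivative (M ** mexp (t *\<^sub>C M)) $ i $ j) (at t)" for t
    by (simp add: ps c_def)
  have "((\<lambda>x. mexp ((k * of_real x + m) *\<^sub>C M) $ i $ j) has_vector_derivative
      k * (M ** mexp ((k * of_real x + m) *\<^sub>C M)) $ i $ j) (at x within T)"
    by (rule field_vector_diff_chain_within[of _ _ _ _ "\<lambda>t. mexp (t *\<^sub>C M) $ i $ j", unfolded o_def])
      (auto intro!: derivative_eq_intros has_field_derivative_at_within[OF d])
  then show "((\<lambda>x. mexp ((k * of_real x + m) *\<^sub>C M) $ i $ j) has_vector_derivative
      (k *\<^sub>C (M ** mexp ((k * of_real x + m) *\<^sub>C M))) $ i $ j) (at x within T)"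
    by simp
qed

text \<open>Based on the resolvent identity \<open>eq\<close>: the local bound on the inverses first
  gives their continuity, and then the difference quotient converges factor by factor.\<close>

lemma matrix_inv_has_vector_derivative:
  fixes S :: "real \<Rightarrow> complex ^ 'n ^ 'n"
  assumes S: "(S has_vector_derivative S') (at x within T)" and "x \<in> T"
    and inv: "\<And>y. y \<in> T \<Longrightarrow> S y ** matrix_inv (S y) = mat 1 \<and> matrix_inv (S y) ** S y = mat 1"
    and bound: "\<forall>\<^sub>F y in at x within T. norm (matrix_inv (S y)) \<le> K"
  shows "((\<lambda>y. matrix_inv (S y)) has_vector_derivative - (matrix_inv (S x) ** S' ** matrix_inv (S x))) (at x within T)"
proof -
  let ?I = "\<lambda>y. matrix_inv (S y)"
  let ?F = "at x within T"
  have eq: "?I y - ?I x = - (?I y ** (S y - S x) ** ?I x)" if "y \<in> T" for y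
    using inv[OF that] inv[OF \<open>x \<in> T\<close>]
    by (simp add: mat_mult_diff) (metis matrix_mul_assoc matrix_mul_rid matrix_mul_lid)
  have T: "\<forall>\<^sub>F y in ?F. y \<in> T \<and> y \<noteq> x"
    by (auto simp: eventually_at_filter)
  have Scont: "((\<lambda>y. S y - S x) \<longlongrightarrow> 0) ?F"
    using has_vector_derivative_continuous[OF S] by (simp add: continuous_within LIM_zero)
  have "((\<lambda>y. ?I y - ?I x) \<longlongrightarrow> 0) ?F"
  proof (rule Lim_null_comparison)
    show "\<forall>\<^sub>F y in ?F. norm (?I y - ?I x) \<le> K * norm (S y - S x) * norm (?I x)"
      using T bound
    proof eventually_elim
      case (elim y)
      then show ?case
        by (simp add: eq norm_mat_mult_le mult_mono norm_mat_mult)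
    qed
    show "((\<lambda>y. K * norm (S y - S x) * norm (?I x)) \<longlongrightarrow> 0) ?F"
      using tendsto_norm_zero[OF Scont] by (auto intro!: tendsto_mult_left_zero tendsto_mult_right_zero)
  qed
  then have Icont: "(?I \<longlongrightarrow> ?I x) ?F"
    by (simp add: LIM_zero_iff)
  have "((\<lambda>y. (1 / (y - x)) *\<^sub>R (S y - S x)) \<longlongrightarrow> S') ?F"
    using S by (simp add: has_vector_derivative_iff_quotient)
  then have "((\<lambda>y. - (?I y ** ((1 / (y - x)) *\<^sub>R (S y - S x)) ** ?I x)) \<longlongrightarrow> - (?I x ** S' ** ?I x)) ?F"
    by (intro tendsto_minus bounded_bilinear.tendsto[OF bounded_bilinear_mat_mult] Icont tendsto_const)
  then have "((\<lambda>y. (1 / (y - x)) *\<^sub>R (?I y - ?I x)) \<longlongrightarrow> - (?I x ** S' ** ?I x)) ?F"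
    by (rule Lim_transform_eventually)
      (rule eventually_mono[OF T], simp add: eq scaleR_smult_mat)
  then show ?thesis by (simp add: has_vector_derivative_iff_quotient)
qed

lemma mult_exp_mono:
  fixes C C' K K' x y :: real
  assumes "C \<le> C'" "0 \<le> C" "K \<le> K'" "0 \<le> K'" "0 \<le> x" "x \<le> y"
  shows "C * exp (K * x) \<le> C' * exp (K' * y)"
proof -
  have "K * x \<le> K' * x" using assms by (intro mult_right_mono)
  also have "\<dots> \<le> K' * y" using assms by (intro mult_left_mono)
  finally have "exp (K * x) \<le> exp (K' * y)" by simp
  then show ?thesis using assms by (intro mult_mono) auto
qed

section \<open>Uniqueness of the fundamental solution\<close>

lemma normalised_fundamental_solution_unique:
  assumes bounded: "\<And>l. bounded (V ` {0..l})"
    and Y: "normalised_fundamental_solution V z Y" and Z: "normalised_fundamental_solution V z Z"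
    and "x \<ge> 0"
  shows "Y x = Z x"
proof -
  obtain b where b: "\<And>y. y \<in> {0..x} \<Longrightarrow> norm (V y) \<le> b"
    using bounded[of x] unfolding bounded_iff by blast
  let ?F = "\<lambda>y. (\<i> * z) *\<^sub>C jmat + jmat ** V y"
  let ?K = "norm ((\<i> * z) *\<^sub>C (jmat :: complex ^ ('a + 'a) ^ ('a + 'a))) + norm (jmat :: complex ^ ('a + 'a) ^ ('a + 'a)) * b"
  have "norm (Y x - Z x) \<le> norm (Y 0 - Z 0) * exp (?K * x)"
  proof (rule gronwall_norm)
    fix y assume y: "0 \<le> y" "y \<le> x"
    have "(Y has_vector_derivative ?F y ** Y y) (at y within {0..x})"
      "(Z has_vector_derivative ?F y ** Z y) (at y within {0..x})"
      using Y Z y unfolding normalised_fundamental_solution_def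
      by (auto intro!: has_vector_derivative_within_subset[where S = "{0..}" and T = "{0..x}"])
    then show "((\<lambda>x. Y x - Z x) has_vector_derivative ?F y ** (Y y - Z y)) (at y within {0..x})"
      by (auto simp: mat_mult_diff(1) intro!: has_vector_derivative_diff)
    have "norm (?F y) \<le> ?K"
      using b[of y] y by (intro norm_triangle_le add_mono norm_mat_mult_le) auto
    then show "norm (?F y ** (Y y - Z y)) \<le> ?K * norm (Y y - Z y)"
      by (rule norm_mat_mult_le) simp
  qed fact
  then show ?thesis
    using Y Z by (simp add: normalised_fundamental_solution_def)
qed

text \<open>Removes the choice operator in \<open>dirac_W\<close>: an explicit solution shows that
  the choice succeeds and, by uniqueness, coincides with the chosen one on the half-line.\<close>

lemma dirac_W_eq:
  assumes "\<And>l. bounded (V ` {0..l})" "normalised_fundamental_solution V z Y" "x \<ge> 0"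
  shows "dirac_W V x z = Y x"
  unfolding dirac_W_def
  by (rule normalised_fundamental_solution_unique[OF assms(1) someI[of "normalised_fundamental_solution V z" Y] assms(2,3)])
    (rule assms(2))

text \<open>All seed objects have blocks that are scalar multiples of the identity, so computing
  with them reduces to 2 by 2 scalar matrices.\<close>

definition blk :: "complex \<Rightarrow> complex \<Rightarrow> complex \<Rightarrow> complex \<Rightarrow> complex ^ ('p::finite + 'p) ^ ('p + 'p)"
  where "blk k l m n = vcat (hcat (k *\<^sub>C mat 1) (l *\<^sub>C mat 1)) (hcat (m *\<^sub>C mat 1) (n *\<^sub>C mat 1))"

lemma blk_mult: "blk k l m n ** blk k' l' m' n' = blk (k * k' + l * m') (k * l' + l * n') (m * k' + n * m') (m * l' + n * n')"
  and blk_add: "blk k l m n + blk k' l' m' n' = blk (k + k') (l + l') (m + m') (n + n')"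
  and smult_blk: "q *\<^sub>C blk k l m n = blk (q * k) (q * l) (q * m) (q * n)"
  and mat_one_blk: "mat 1 = blk 1 0 0 1"
  and jmat_blk: "jmat = blk 1 0 0 (- 1)"
  by (simp_all add: blk_def block_simps smult_mat_add mat_one_block jmat_def mult.commute)

lemma blk_cong: "\<lbrakk>k = k'; l = l'; m = m'; n = n'\<rbrakk> \<Longrightarrow> blk k l m n = blk k' l' m' n'"
  by simp

lemma blk_mult_vcat: "blk k l m n ** vcat (r *\<^sub>C mat 1) (s *\<^sub>C mat 1) = vcat ((k * r + l * s) *\<^sub>C mat 1) ((m * r + n * s) *\<^sub>C mat 1)"
  and hcat_mult_blk: "hcat (r *\<^sub>C mat 1) (s *\<^sub>C mat 1) ** blk k l m n = hcat ((r * k + s * m) *\<^sub>C mat 1) ((r * l + s * n) *\<^sub>C mat 1)"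
  by (simp_all add: blk_def block_simps smult_mat_add mult.commute)

lemma blk_has_vector_derivative:
  assumes "(k has_vector_derivative k') (at x within T)" "(l has_vector_derivative l') (at x within T)"
    "(m has_vector_derivative m') (at x within T)" "(n has_vector_derivative n') (at x within T)"
  shows "((\<lambda>x. blk (k x) (l x) (m x) (n x)) has_vector_derivative blk k' l' m' n') (at x within T)"
proof (rule has_vector_derivative_mat)
  fix i j :: "'a + 'a"
  show "((\<lambda>x. blk (k x) (l x) (m x) (n x) $ i $ j) has_vector_derivative blk k' l' m' n' $ i $ j) (at x within T)"
    using assms by (cases i; cases j) (auto simp: blk_def intro!: has_vector_derivative_mult_left)
qed

lemma exp_ix_deriv: "((\<lambda>x. exp (k * of_real x)) has_vector_derivative k * exp (k * of_real x)) (at x within T)"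
  for k :: complex
  by (rule field_vector_diff_chain_within[of _ _ _ _ "\<lambda>t. exp (k * t)" "k * exp (k * of_real x)", unfolded o_def, THEN has_vector_derivative_eq_rhs])
    (auto intro!: derivative_eq_intros)

text \<open>Needed because the two expressions for the transformed potential are identified only for
  x \<ge> 0, where S(x) is known to be hermitian and invertible.\<close>

lemma weyl_GW_cong:
  assumes "\<And>x. x \<ge> 0 \<Longrightarrow> V x = V' x"
  shows "weyl_function V = weyl_function V'" "GW_function V = GW_function V'"
proof -
  have "normalised_fundamental_solution V z Y = normalised_fundamental_solution V' z Y" for z Y
    using assms by (auto simp: normalised_fundamental_solution_def)
  then have W: "dirac_W V = dirac_W V'"
    by (simp add: dirac_W_def fun_eq_iff)
  have "V ` {0..l} = V' ` {0..l}" for l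
    using assms by (intro image_cong) auto
  with W show "weyl_function V = weyl_function V'" "GW_function V = GW_function V'"
    by (simp_all add: weyl_function_def GW_function_def fun_eq_iff)
qed

lemma has_vector_derivative_mat_nth:
  fixes F :: "real \<Rightarrow> complex ^ 'p ^ 'm"
  assumes "(F has_vector_derivative F') (at x within T)"
  shows "((\<lambda>x. F x $ i $ j) has_vector_derivative F' $ i $ j) (at x within T)"
  using tendsto_vec_nth[OF tendsto_vec_nth[OF assms[unfolded has_vector_derivative_iff_quotient]]]
  unfolding has_vector_derivative_iff_quotient by simp

lemma hcat_has_vector_derivative:
  fixes F :: "real \<Rightarrow> complex ^ 'p ^ 'm" and G :: "real \<Rightarrow> complex ^ 'q ^ 'm"
  assumes "(F has_vector_derivative F') (at x within T)" "(G has_vector_derivative G') (at x within T)"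
  shows "((\<lambda>x. hcat (F x) (G x)) has_vector_derivative hcat F' G') (at x within T)"
proof (rule has_vector_derivative_mat)
  fix i j
  show "((\<lambda>x. hcat (F x) (G x) $ i $ j) has_vector_derivative hcat F' G' $ i $ j) (at x within T)"
  proof (cases j)
    case (Inl l)
    show ?thesis using has_vector_derivative_mat_nth[OF assms(1), of i l] by (simp add: Inl)
  next
    case (Inr r)
    show ?thesis using has_vector_derivative_mat_nth[OF assms(2), of i r] by (simp add: Inr)
  qed
qed

text \<open>The commutator of \<open>B\<close> with the exponential solves the linear equation D' =
  kMD and vanishes at 0, so Gronwall makes it zero.\<close>

lemma mexp_commute:
  fixes B M :: "complex ^ 'n ^ 'n"
  assumes "B ** M = M ** B" "x \<ge> 0"
  shows "B ** mexp ((k * of_real x) *\<^sub>C M) = mexp ((k * of_real x) *\<^sub>C M) ** B"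
proof -
  let ?E = "\<lambda>x. mexp ((k * of_real x) *\<^sub>C M)"
  let ?D = "\<lambda>x. B ** ?E x - ?E x ** B"
  have "norm (?D x) \<le> norm (?D 0) * exp (norm (k *\<^sub>C M) * x)"
  proof (rule gronwall_norm[OF _ _ assms(2)])
    fix y :: real assume "0 \<le> y"
    have E: "(?E has_vector_derivative k *\<^sub>C (M ** ?E y)) (at y within {0..x})"
      using mexp_has_vector_derivative[of k 0 M] by simp
    show "(?D has_vector_derivative (k *\<^sub>C M) ** ?D y) (at y within {0..x})"
      by (rule has_vector_derivative_eq_rhs[OF has_vector_derivative_diff[OF
              mat_mult_has_vector_derivative[OF has_vector_derivative_const E]
              mat_mult_has_vector_derivative[OF E has_vector_derivative_const]]])
        (simp add: mat_mult_diff smult_mat_diff, simp only: matrix_mul_assoc assms(1))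
    show "norm ((k *\<^sub>C M) ** ?D y) \<le> norm (k *\<^sub>C M) * norm (?D y)"
      by (rule norm_mat_mult)
  qed
  then show ?thesis by (simp add: mexp_zero)
qed

lemma cadjoint_blk: "cadjoint (blk k l m n) = blk (cnj k) (cnj m) (cnj l) (cnj n)"
  by (simp add: blk_def block_simps cadjoint_smult)

lemma norm_blk_antidiag: "norm (blk 0 l m 0 :: complex ^ ('p::finite + 'p) ^ ('p + 'p)) \<le>
    (cmod l + cmod m) * norm (mat 1 :: complex ^ 'p ^ 'p)"
proof -
  have "norm (blk 0 l m 0 :: complex ^ ('p + 'p) ^ ('p + 'p)) \<le>
      norm (hcat (0 :: complex ^ 'p ^ 'p) (l *\<^sub>C (mat 1 :: complex ^ 'p ^ 'p))) + norm (hcat (m *\<^sub>C (mat 1 :: complex ^ 'p ^ 'p)) (0 :: complex ^ 'p ^ 'p))"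
    unfolding blk_def by (rule order_trans[OF norm_vcat]) simp
  also have "\<dots> \<le> cmod l * norm (mat 1 :: complex ^ 'p ^ 'p) + cmod m * norm (mat 1 :: complex ^ 'p ^ 'p)"
    using norm_hcat[of "0 :: complex ^ 'p ^ 'p" "l *\<^sub>C (mat 1 :: complex ^ 'p ^ 'p)"] norm_hcat[of "m *\<^sub>C (mat 1 :: complex ^ 'p ^ 'p)" "0 :: complex ^ 'p ^ 'p"]
    by (intro add_mono) simp_all
  finally show ?thesis by (simp add: algebra_simps)
qed

lemma integral_half_line_has_vector_derivative:
  fixes f :: "real \<Rightarrow> 'a::banach"
  assumes "continuous_on {0..} f" "x \<ge> 0"
    and G: "\<And>y. y \<ge> 0 \<Longrightarrow> G y = G0 + integral {0..y} f"
  shows "(G has_vector_derivative f x) (at x within {0..})"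
proof -
  \<comment> \<open>The fundamental theorem is stated on compact intervals; the right end
    \<open>x + 1\<close> keeps a one-sided neighbourhood of \<open>x\<close> inside, so the filter
    is the one of the half-line.\<close>
  have "((\<lambda>y. integral {0..y} f) has_vector_derivative f x) (at x within {0..x + 1})"
    by (rule integral_has_vector_derivative[OF continuous_on_subset[OF assms(1)]]) (use \<open>x \<ge> 0\<close> in auto)
  then have "((\<lambda>y. G0 + integral {0..y} f) has_vector_derivative f x) (at x within {0..x + 1})"
    using has_vector_derivative_add[OF has_vector_derivative_const[of G0]] by fastforce
  moreover have "at x within {0..x + 1} = at x within {0..}"
    by (rule at_within_nhd[of x "{..<x + 1}"]) auto
  ultimately have "((\<lambda>y. G0 + integral {0..y} f) has_vector_derivative f x) (at x within {0..})"
    by simp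
  then show ?thesis
    by (rule has_vector_derivative_transform[rotated 2]) (use G \<open>x \<ge> 0\<close> in auto)
qed

section \<open>The Darboux transformation\<close>

text \<open>The quadratic form attains a positive minimum on the compact unit sphere of matrices;
  homogeneity does the rest.\<close>

lemma posdef_lower_bound:
  fixes B :: "complex ^ 'n ^ 'n"
  assumes "posdef B"
  obtains s where "s > 0" "\<And>Y :: complex ^ 'n ^ 'n. s * (norm Y)\<^sup>2 \<le> inner Y (B ** Y)"
proof -
  let ?q = "\<lambda>Y :: complex ^ 'n ^ 'n. inner Y (B ** Y)"
  have pos: "0 < ?q Y" if nz: "Y \<noteq> 0" for Y
  proof -
    define r where "r u = Re (\<Sum>i\<in>UNIV. cnj (u $ i) * (B *v u) $ i)" for u
    have r_pos: "u \<noteq> 0 \<Longrightarrow> 0 < r u" for u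
      using assms unfolding posdef_def r_def by blast
    have r_nonneg: "0 \<le> r u" for u
      using r_pos[of u] by (cases "u = 0") (auto simp: r_def)
    have "?q Y = (\<Sum>i\<in>UNIV. \<Sum>j\<in>UNIV. Re (cnj (Y $ i $ j) * (B ** Y) $ i $ j))"
      by (simp add: inner_vec_def inner_complex_def)
    \<comment> \<open>The matrix form splits into the vector forms of the columns, to which
      \<open>posdef\<close> applies.\<close>
    also have "\<dots> = (\<Sum>j\<in>UNIV. r (column j Y))"
      by (subst sum.swap) (simp add: r_def column_def mat_mult_nth matrix_vector_mult_def)
    finally have q: "?q Y = (\<Sum>j\<in>UNIV. r (column j Y))" .
    obtain i j where "Y $ i $ j \<noteq> 0"
      using nz by (auto simp: vec_eq_iff)
    then have "column j Y \<noteq> 0" by (auto simp: vec_eq_iff column_def)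
    then show ?thesis
      unfolding q by (intro sum_pos2[of _ j]) (auto intro: r_pos r_nonneg)
  qed
  have cont: "continuous_on (sphere 0 1) ?q"
    by (intro continuous_intros bounded_bilinear.continuous_on[OF bounded_bilinear_mat_mult])
  have "norm ((1 / norm (mat 1 :: complex ^ 'n ^ 'n)) *\<^sub>R (mat 1 :: complex ^ 'n ^ 'n)) = 1"
    by (simp add: vec_eq_iff mat_def)
  then have "sphere 0 1 \<noteq> ({} :: (complex ^ 'n ^ 'n) set)"
    by (metis dist_0_norm empty_iff mem_sphere)
  then obtain Y0 where Y0: "Y0 \<in> sphere 0 1" and min: "\<And>Y. Y \<in> sphere 0 1 \<Longrightarrow> ?q Y0 \<le> ?q Y"
    using continuous_attains_inf[OF compact_sphere _ cont] by blast
  show ?thesis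
  proof
    show "?q Y0 > 0" using Y0 by (intro pos) auto
    fix Y :: "complex ^ 'n ^ 'n"
    show "?q Y0 * (norm Y)\<^sup>2 \<le> ?q Y"
    proof (cases "Y = 0")
      case False
      then have "?q Y0 \<le> ?q ((1 / norm Y) *\<^sub>R Y)" by (intro min) auto
      also have "\<dots> = ?q Y / (norm Y)\<^sup>2"
        by (simp add: power2_eq_square bounded_bilinear.scaleR_right[OF bounded_bilinear_mat_mult])
      finally show ?thesis using False by (simp add: field_simps)
    qed auto
  qed
qed

text \<open>A generalised Backlund-Darboux transformation of a seed potential \<open>V\<close> that
  is hermitian with zero diagonal blocks (it anticommutes with \<open>jmat\<close>). The bound
  \<open>b\<close> is global in x, so that P grows at a fixed exponential rate.\<close>

locale gbdt =
  fixes A :: "complex ^ 'n ^ 'n"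
    and P :: "real \<Rightarrow> complex ^ ('p::finite + 'p) ^ 'n"
    and S :: "real \<Rightarrow> complex ^ 'n ^ 'n"
    and V :: "real \<Rightarrow> complex ^ ('p + 'p) ^ ('p + 'p)"
    and b :: real
  assumes P_deriv: "\<And>x. x \<ge> 0 \<Longrightarrow>
      (P has_vector_derivative - (\<i> *\<^sub>C (A ** P x ** jmat)) - P x ** jmat ** V x) (at x within {0..})"
    and S_deriv: "\<And>x. x \<ge> 0 \<Longrightarrow> (S has_vector_derivative P x ** jmat ** cadjoint (P x)) (at x within {0..})"
    and S_identity_0: "A ** S 0 - S 0 ** cadjoint A = \<i> *\<^sub>C (P 0 ** cadjoint (P 0))"
    and posdef_S0: "posdef (S 0)"
    and V_herm: "cadjoint (V x) = V x"
    and V_jmat: "V x ** jmat = - (jmat ** V x)"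
    and V_bound: "x \<ge> 0 \<Longrightarrow> norm (V x) \<le> b"
begin

abbreviation "Ps x \<equiv> cadjoint (P x)"
abbreviation "As \<equiv> cadjoint A"
abbreviation "Si x \<equiv> matrix_inv (S x)"

text \<open>Normal form for right-nested products: \<open>jmat\<close> moves to the left of
  \<open>V\<close> and its squares cancel. The derivative identities below then close by
  rewriting.\<close>

lemma V_jmat_mult: "V x ** (jmat ** M) = - (jmat ** (V x ** M))"
  by (metis V_jmat mat_mult_minus(2) matrix_mul_assoc)

lemma jmat_jmat_mult [simp]: "jmat ** (jmat ** M) = M"
  by (simp add: matrix_mul_assoc)

lemma Ps_deriv: "x \<ge> 0 \<Longrightarrow>
    (Ps has_vector_derivative \<i> *\<^sub>C (jmat ** Ps x ** As) + jmat ** V x ** Ps x) (at x within {0..})"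
  by (rule has_vector_derivative_eq_rhs[OF cadjoint_has_vector_derivative[OF P_deriv]])
    (simp_all add: cadjoint_diff cadjoint_minus cadjoint_smult cadjoint_mult V_herm V_jmat_mult mat_distribs)

lemma S_herm: "x \<ge> 0 \<Longrightarrow> cadjoint (S x) = S x"
proof -
  assume "x \<ge> 0"
  have "((\<lambda>x. cadjoint (S x) - S x) has_vector_derivative 0) (at y within {0..})" if "y \<in> {0..}" for y
    by (rule has_vector_derivative_eq_rhs[OF has_vector_derivative_diff[OF
          cadjoint_has_vector_derivative[OF S_deriv] S_deriv]])
      (use that in \<open>auto simp: cadjoint_mult mat_distribs\<close>)
  from has_vector_derivative_zero_constant[OF _ this]
  obtain c where "\<And>y. y \<in> {0..} \<Longrightarrow> cadjoint (S y) - S y = c"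
    by (metis convex_real_interval(1))
  from this[of x] this[of 0] \<open>x \<ge> 0\<close> posdef_S0
  show ?thesis by (simp add: posdef_def)
qed

text \<open>In the derivative of P P^* the two \<open>V\<close> terms cancel, and the
  \<open>A\<close> terms are exactly those of AS' - S'A^* up to the factor i; so the defect is
  constant and vanishes at 0.\<close>

lemma S_identity: "A ** S x - S x ** As = \<i> *\<^sub>C (P x ** Ps x)" if "x \<ge> 0"
proof -
  let ?D = "\<lambda>x. A ** S x - S x ** As - \<i> *\<^sub>C (P x ** Ps x)"
  have "(?D has_vector_derivative 0) (at y within {0..})" if "y \<in> {0..}" for y
    by (rule has_vector_derivative_eq_rhs[OF has_vector_derivative_diff[OF has_vector_derivative_diff[OF
          mat_mult_has_vector_derivative[OF has_vector_derivative_const S_deriv]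
          mat_mult_has_vector_derivative[OF S_deriv has_vector_derivative_const]]
          smult_mat_has_vector_derivative[OF has_vector_derivative_const
            mat_mult_has_vector_derivative[OF P_deriv Ps_deriv]]]])
      (use that in \<open>auto simp: mat_distribs\<close>)
  from has_vector_derivative_zero_constant[OF _ this]
  obtain c where "\<And>y. y \<in> {0..} \<Longrightarrow> ?D y = c"
    by (metis convex_real_interval(1))
  from this[of x] this[of 0] \<open>x \<ge> 0\<close> S_identity_0
  show ?thesis by simp
qed

text \<open>The form in which the identity enters all later computations: a product of
  \<open>P x\<close> and \<open>Ps x\<close> is traded for terms with \<open>S x\<close>, which then
  cancel against \<open>Si x\<close>.\<close>

lemma P_Ps_mult: "x \<ge> 0 \<Longrightarrow> P x ** (Ps x ** M) = - (\<i> *\<^sub>C (A ** (S x ** M))) + \<i> *\<^sub>C (S x ** (As ** M))"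
proof -
  assume "x \<ge> 0"
  have "P x ** Ps x = - (\<i> *\<^sub>C (\<i> *\<^sub>C (P x ** Ps x)))"
    by simp
  also have "\<dots> = - (\<i> *\<^sub>C (A ** S x)) + \<i> *\<^sub>C (S x ** As)"
    by (simp add: S_identity[OF \<open>x \<ge> 0\<close>, symmetric] smult_mat_diff del: smult_mat_smult)
  finally have "P x ** Ps x ** M = (- (\<i> *\<^sub>C (A ** S x)) + \<i> *\<^sub>C (S x ** As)) ** M"
    by simp
  then show ?thesis by (simp add: mat_distribs)
qed

lemma P_bound: "x \<ge> 0 \<Longrightarrow> norm (P x) \<le> norm (P 0) * exp ((norm A + b) * norm (jmat :: complex ^ ('p + 'p) ^ ('p + 'p)) * x)"
proof (rule gronwall_norm)
  let ?j = "jmat :: complex ^ ('p + 'p) ^ ('p + 'p)"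
  fix y :: real assume y: "0 \<le> y" "y \<le> x"
  show "(P has_vector_derivative - (\<i> *\<^sub>C (A ** P y ** jmat)) - P y ** jmat ** V y) (at y within {0..x})"
    by (rule has_vector_derivative_within_subset[OF P_deriv]) (use y in auto)
  have "norm (- (\<i> *\<^sub>C (A ** P y ** jmat)) - P y ** jmat ** V y) \<le> norm (\<i> *\<^sub>C (A ** P y ** jmat)) + norm (P y ** jmat ** V y)"
    by (metis norm_minus_cancel norm_triangle_ineq4)
  also have "\<dots> \<le> norm A * norm (P y) * norm ?j + norm (P y) * norm ?j * b"
    using V_bound[OF y(1)] by (auto intro!: add_mono norm_mat_mult_le norm_mat_mult)
  finally show "norm (- (\<i> *\<^sub>C (A ** P y ** jmat)) - P y ** jmat ** V y) \<le> (norm A + b) * norm ?j * norm (P y)"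
    by (simp add: algebra_simps)
qed

text \<open>Along \<eta>' = i A^* \<eta> the derivative of the form (\<eta>, S \<eta>) equals (q, (I
  + j) q) with q = P^* \<eta>, since \<open>S_identity\<close> turns the \<open>A\<close> terms into
  P P^*. Hence the form increases from 0 to x.\<close>

lemma S_lower_bound:
  fixes Y :: "complex ^ 'n ^ 'n"
  assumes "x \<ge> 0" and s: "0 < s" "\<And>Y :: complex ^ 'n ^ 'n. s * (norm Y)\<^sup>2 \<le> inner Y (S 0 ** Y)"
  shows "s * exp (- 2 * norm A * x) * (norm Y)\<^sup>2 \<le> inner Y (S x ** Y)"
proof -
  \<comment> \<open>Normalised at the right end, so that \<eta>(x) = Y; Gronwall then compares |Y|
    with |\<eta>(0)|.\<close>
  define \<eta> where "\<eta> r = mexp ((\<i> * of_real r + - (\<i> * of_real x)) *\<^sub>C As) ** Y" for r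
  have \<eta>: "(\<eta> has_vector_derivative \<i> *\<^sub>C (As ** \<eta> r)) (at r within T)" for r T
    unfolding \<eta>_def
    by (rule has_vector_derivative_eq_rhs[OF mat_mult_has_vector_derivative[OF mexp_has_vector_derivative has_vector_derivative_const]])
      (simp add: mat_distribs)
  have \<eta>x: "\<eta> x = Y"
    by (simp add: \<eta>_def mexp_zero)
  have "norm (\<i> *\<^sub>C (As ** \<eta> r)) \<le> norm A * norm (\<eta> r)" for r
    using norm_mat_mult[of As "\<eta> r"] by simp
  from gronwall_norm[OF \<eta> this \<open>x \<ge> 0\<close>]
  have "norm Y \<le> norm (\<eta> 0) * exp (norm A * x)" by (simp add: \<eta>x)
  then have "exp (- (norm A * x)) * norm Y \<le> norm (\<eta> 0)"
    by (simp add: exp_minus field_simps)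
  then have "(exp (- (norm A * x)) * norm Y)\<^sup>2 \<le> (norm (\<eta> 0))\<^sup>2"
    by (intro power_mono) auto
  then have "s * exp (- 2 * norm A * x) * (norm Y)\<^sup>2 \<le> s * (norm (\<eta> 0))\<^sup>2"
    using s(1) by (simp add: power_mult_distrib mult.assoc flip: exp_double)
  also have "\<dots> \<le> inner (\<eta> 0) (S 0 ** \<eta> 0)"
    by (rule s)
  also have "\<dots> \<le> inner (\<eta> x) (S x ** \<eta> x)"
  proof (rule has_real_derivative_nonneg_imp_le[OF _ _ \<open>x \<ge> 0\<close>])
    fix r assume r: "0 \<le> r" "r \<le> x"
    \<comment> \<open>I + j is twice an orthogonal projection, so its quadratic form is half the
      squared norm of its image.\<close>
    let ?T = "mat 1 + jmat :: complex ^ ('p + 'p) ^ ('p + 'p)"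
    have norm_T: "2 * inner q (?T ** q) = (norm (?T ** q))\<^sup>2" for q :: "complex ^ 'n ^ ('p + 'p)"
    proof -
      have "?T ** (?T ** q) = 2 *\<^sub>R (?T ** q)"
        by (simp add: mat_distribs scaleR_2)
      then show ?thesis
        unfolding power2_norm_eq_inner inner_mat_cadjoint by (simp add: cadjoint_add)
    qed
    have "((\<lambda>r. inner (\<eta> r) (S r ** \<eta> r)) has_vector_derivative
        inner (\<eta> r) (S r ** (\<i> *\<^sub>C (As ** \<eta> r)) + P r ** jmat ** Ps r ** \<eta> r) + inner (\<i> *\<^sub>C (As ** \<eta> r)) (S r ** \<eta> r))
        (at r within {0..x})"
      by (intro bounded_bilinear.has_vector_derivative[OF bounded_bilinear_inner] \<eta> mat_mult_has_vector_derivative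
          has_vector_derivative_within_subset[OF S_deriv]) (use r in auto)
    moreover have "inner (\<i> *\<^sub>C (As ** \<eta> r)) (S r ** \<eta> r) = inner (\<eta> r) (- (\<i> *\<^sub>C (A ** (S r ** \<eta> r))))"
      using inner_mat_cadjoint[of "\<i> *\<^sub>C As" "\<eta> r" "S r ** \<eta> r"] by (simp add: cadjoint_smult)
    moreover have "inner (Ps r ** \<eta> r) (?T ** (Ps r ** \<eta> r)) =
        inner (\<eta> r) (- (\<i> *\<^sub>C (A ** (S r ** \<eta> r))) + \<i> *\<^sub>C (S r ** (As ** \<eta> r)) + P r ** jmat ** Ps r ** \<eta> r)"
      using r by (simp add: inner_mat_cadjoint[of "Ps r"] mat_distribs P_Ps_mult)
    ultimately have "((\<lambda>r. inner (\<eta> r) (S r ** \<eta> r)) has_vector_derivative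
        inner (Ps r ** \<eta> r) (?T ** (Ps r ** \<eta> r))) (at r within {0..x})"
      by (elim has_vector_derivative_eq_rhs) (simp add: inner_add_right inner_diff_right)
    then show "((\<lambda>r. inner (\<eta> r) (S r ** \<eta> r)) has_real_derivative
        (norm (?T ** (Ps r ** \<eta> r)))\<^sup>2 / 2) (at r within {0..x})"
      unfolding has_real_derivative_iff_has_vector_derivative
      by (elim has_vector_derivative_eq_rhs) (use norm_T in \<open>simp add: field_simps\<close>)
  qed simp
  finally show ?thesis by (simp add: \<eta>x)
qed

text \<open>Cauchy-Schwarz turns the quadratic lower bound into the norm bound that
  \<open>mat_inv_of_lower_bound\<close> asks for.\<close>

lemma S_inverse:
  obtains K where "K \<ge> 0"
    "\<And>x. x \<ge> 0 \<Longrightarrow> S x ** Si x = mat 1 \<and> Si x ** S x = mat 1 \<and> norm (Si x) \<le> K * exp (2 * norm A * x)"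
proof -
  obtain s where s: "0 < s" "\<And>Y :: complex ^ 'n ^ 'n. s * (norm Y)\<^sup>2 \<le> inner Y (S 0 ** Y)"
    using posdef_lower_bound[OF posdef_S0] by blast
  show ?thesis
  proof
    show "0 \<le> norm (mat 1 :: complex ^ 'n ^ 'n) / s" using s(1) by simp
    fix x :: real assume x: "x \<ge> 0"
    let ?s = "s * exp (- 2 * norm A * x)"
    have "?s * norm Y \<le> norm (S x ** Y)" for Y :: "complex ^ 'n ^ 'n"
    proof (cases "Y = 0")
      case False
      have "?s * (norm Y)\<^sup>2 \<le> norm Y * norm (S x ** Y)"
        using S_lower_bound[OF x s, of Y] norm_cauchy_schwarz[of Y "S x ** Y"] by linarith
      then show ?thesis using False by (simp add: power2_eq_square)
    qed auto
    from mat_inv_of_lower_bound[OF _ this] s(1)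
    show "S x ** Si x = mat 1 \<and> Si x ** S x = mat 1 \<and>
        norm (Si x) \<le> norm (mat 1 :: complex ^ 'n ^ 'n) / s * exp (2 * norm A * x)"
      by (simp add: exp_minus field_simps)
  qed
qed

lemma Si_S [simp]: "x \<ge> 0 \<Longrightarrow> Si x ** S x = mat 1" "x \<ge> 0 \<Longrightarrow> S x ** Si x = mat 1"
  using S_inverse by blast+

lemma Si_S_mult [simp]: "x \<ge> 0 \<Longrightarrow> Si x ** (S x ** M) = M" "x \<ge> 0 \<Longrightarrow> S x ** (Si x ** M) = M"
  by (simp_all add: matrix_mul_assoc)

lemma Si_herm: "cadjoint (Si x) = Si x" if "x \<ge> 0"
proof -
  have "cadjoint (Si x) ** S x = mat 1"
    using arg_cong[OF Si_S(2)[OF that], of cadjoint] by (simp add: cadjoint_mult S_herm[OF that])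
  then have "cadjoint (Si x) ** S x ** Si x = Si x" by simp
  then show ?thesis using that by (simp add: mat_mult_assoc)
qed

lemma Si_deriv: "x \<ge> 0 \<Longrightarrow>
    (Si has_vector_derivative - (Si x ** (P x ** jmat ** Ps x) ** Si x)) (at x within {0..})"
proof -
  assume x: "x \<ge> 0"
  obtain K where K: "K \<ge> 0"
    "\<And>x. x \<ge> 0 \<Longrightarrow> S x ** Si x = mat 1 \<and> Si x ** S x = mat 1 \<and> norm (Si x) \<le> K * exp (2 * norm A * x)"
    by (rule S_inverse) blast
  \<comment> \<open>The exponential bound on \<open>Si\<close> increases with y, so its value at
    \<open>x + 1\<close> is a bound near \<open>x\<close>.\<close>
  have "\<forall>\<^sub>F y in at x within {0..}. y < x + 1"
    by (rule order_tendstoD(2)[OF tendsto_ident_at]) simp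
  moreover have "\<forall>\<^sub>F y in at x within {0..}. 0 \<le> y"
    by (auto simp: eventually_at_filter)
  ultimately have "\<forall>\<^sub>F y in at x within {0..}. norm (Si y) \<le> K * exp (2 * norm A * (x + 1))"
  proof eventually_elim
    case (elim y)
    have "K * exp (2 * norm A * y) \<le> K * exp (2 * norm A * (x + 1))"
      using elim K(1) by (intro mult_exp_mono) auto
    with K(2)[of y] elim show ?case by linarith
  qed
  with x show ?thesis
    by (intro matrix_inv_has_vector_derivative S_deriv) auto
qed

definition "X x = Ps x ** Si x"

text \<open>The bracket is where the transformed potential appears: it equals
  \<open>jmat ** Vt x\<close> for the \<open>Vt\<close> defined below. Moving \<open>As\<close>
  across \<open>Si x\<close> by the identity produces the summand with
  \<open>jmat ** X x ** P x\<close>.\<close>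

lemma X_deriv: "x \<ge> 0 \<Longrightarrow>
    (X has_vector_derivative \<i> *\<^sub>C (jmat ** X x ** A) + (jmat ** V x + jmat ** X x ** P x - X x ** P x ** jmat) ** X x)
      (at x within {0..})"
  unfolding X_def
  by (rule has_vector_derivative_eq_rhs[OF mat_mult_has_vector_derivative[OF Ps_deriv Si_deriv]])
    (simp_all add: mat_distribs P_Ps_mult)

lemma X_bound:
  obtains C K where "C \<ge> 0" "K \<ge> 0" "\<And>x. x \<ge> 0 \<Longrightarrow> norm (P x) \<le> C * exp (K * x)"
    "\<And>x. x \<ge> 0 \<Longrightarrow> norm (Si x) \<le> C * exp (K * x)"
proof -
  let ?k = "(norm A + b) * norm (jmat :: complex ^ ('p + 'p) ^ ('p + 'p))"
  obtain k where k: "k \<ge> 0"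
    "\<And>x. x \<ge> 0 \<Longrightarrow> S x ** Si x = mat 1 \<and> Si x ** S x = mat 1 \<and> norm (Si x) \<le> k * exp (2 * norm A * x)"
    by (rule S_inverse) blast
  define C where "C = max k (norm (P 0))"
  define K where "K = max (2 * norm A) ?k"
  show ?thesis
  proof
    show "C \<ge> 0" "K \<ge> 0" using k(1) by (auto simp: C_def K_def le_max_iff_disj)
    fix x :: real assume x: "x \<ge> 0"
    have "norm (P 0) * exp (?k * x) \<le> C * exp (K * x)"
      using x k(1) by (intro mult_exp_mono) (auto simp: C_def K_def le_max_iff_disj)
    with P_bound[OF x] show "norm (P x) \<le> C * exp (K * x)" by linarith
    have "k * exp (2 * norm A * x) \<le> C * exp (K * x)"
      using x k(1) by (intro mult_exp_mono) (auto simp: C_def K_def le_max_iff_disj)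
    with k(2)[OF x] show "norm (Si x) \<le> C * exp (K * x)" by linarith
  qed
qed

section \<open>The Darboux matrix, its inverse, and bounds uniform in the spectral parameter\<close>

definition "Res z = matrix_inv (A - z *\<^sub>C mat 1)"
definition "Res' z = matrix_inv (As - z *\<^sub>C mat 1)"
definition "w x z = mat 1 - \<i> *\<^sub>C (X x ** Res z ** P x)"
text \<open>The prime marks the inverse of \<open>w\<close>, not a derivative; likewise
  \<open>Res'\<close> is the resolvent of the adjoint of A.\<close>

definition "w' x z = mat 1 + \<i> *\<^sub>C (Ps x ** Res' z ** Si x ** P x)"

lemma resolvent_mult:
  assumes "norm A < Im z"
  shows "A ** (Res z ** M) = M + z *\<^sub>C (Res z ** M)"
    and "Res z ** (A ** M) = M + z *\<^sub>C (Res z ** M)"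
    and "As ** (Res' z ** M) = M + z *\<^sub>C (Res' z ** M)"
    and "Res' z ** (As ** M) = M + z *\<^sub>C (Res' z ** M)"
proof -
  have z: "norm A + (Im z - norm A) \<le> cmod z" "norm As + (Im z - norm A) \<le> cmod z" "0 < Im z - norm A"
    using assms abs_Im_le_cmod[of z] by auto
  have "(A - z *\<^sub>C mat 1) ** Res z ** M = M" "Res z ** (A - z *\<^sub>C mat 1) ** M = M"
    "(As - z *\<^sub>C mat 1) ** Res' z ** M = M" "Res' z ** (As - z *\<^sub>C mat 1) ** M = M"
    unfolding Res_def Res'_def
    using mat_inv_diff_scalar[OF z(1,3)] mat_inv_diff_scalar[OF z(2,3)] by simp_all
  then show "A ** (Res z ** M) = M + z *\<^sub>C (Res z ** M)"
    and "Res z ** (A ** M) = M + z *\<^sub>C (Res z ** M)"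
    and "As ** (Res' z ** M) = M + z *\<^sub>C (Res' z ** M)"
    and "Res' z ** (As ** M) = M + z *\<^sub>C (Res' z ** M)"
    by (simp_all add: mat_distribs algebra_simps)
qed

lemma resolvent_bound:
  assumes "norm A < Im z"
  shows "norm (Res z) \<le> norm (mat 1 :: complex ^ 'n ^ 'n) / (Im z - norm A)"
    and "norm (Res' z) \<le> norm (mat 1 :: complex ^ 'n ^ 'n) / (Im z - norm A)"
  using mat_inv_diff_scalar(3)[of A "Im z - norm A" z] mat_inv_diff_scalar(3)[of As "Im z - norm A" z]
    assms abs_Im_le_cmod[of z] unfolding Res_def Res'_def by auto

text \<open>The intertwining relation: new coefficient on the left, seed coefficient on the right.
  Multiplying \<open>w\<close> by a seed solution cancels the right one.\<close>

lemma w_deriv: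
  assumes "x \<ge> 0" "norm A < Im z"
  shows "((\<lambda>x. w x z) has_vector_derivative
      ((\<i> * z) *\<^sub>C jmat + jmat ** V x + jmat ** X x ** P x - X x ** P x ** jmat) ** w x z
        - w x z ** ((\<i> * z) *\<^sub>C jmat + jmat ** V x)) (at x within {0..})"
  unfolding w_def
  by (rule has_vector_derivative_eq_rhs[OF has_vector_derivative_diff[OF has_vector_derivative_const
        smult_mat_has_vector_derivative[OF has_vector_derivative_const
          mat_mult_has_vector_derivative[OF mat_mult_has_vector_derivative[OF X_deriv has_vector_derivative_const] P_deriv]]]])
    (use assms in \<open>simp_all add: mat_distribs resolvent_mult mult.commute[of "\<i> * z"]\<close>)

text \<open>In the quadratic term P P^* becomes a multiple of (A - z) S - S (As - z); each factor
  cancels one resolvent, and the two remainders cancel the linear terms. The other order is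
  finite-dimensional linear algebra.\<close>

lemma w'_w: "w' x z ** w x z = mat 1" and w_w': "w x z ** w' x z = mat 1"
  if "x \<ge> 0" "norm A < Im z"
proof -
  show "w' x z ** w x z = mat 1"
    using that by (simp add: w_def w'_def X_def mat_distribs P_Ps_mult resolvent_mult)
  then show "w x z ** w' x z = mat 1"
    by (simp add: matrix_left_right_inverse)
qed

text \<open>The correction to I contains \<open>P\<close>, its adjoint and \<open>Si\<close> once
  each, hence the exponent 3K, and one resolvent, which is bounded by N when Im z exceeds
  \<open>norm A\<close> by 1. The last estimate records that \<open>w' 0 z\<close> tends to I as Im
  z grows; the lower bound for the solution rests on it.\<close>

lemma w_bounds:
  obtains C K where "C \<ge> 0" "K \<ge> 0"
    "\<And>x z. \<lbrakk>x \<ge> 0; norm A + 1 \<le> Im z\<rbrakk> \<Longrightarrow> norm (w x z) \<le> C * exp (K * x)"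
    "\<And>x z. \<lbrakk>x \<ge> 0; norm A + 1 \<le> Im z\<rbrakk> \<Longrightarrow> norm (w' x z) \<le> C * exp (K * x)"
    "\<And>z. norm A < Im z \<Longrightarrow> norm (w' 0 z - mat 1) \<le> C / (Im z - norm A)"
proof -
  obtain C K where CK: "C \<ge> 0" "K \<ge> 0" and b: "\<And>x. x \<ge> 0 \<Longrightarrow> norm (P x) \<le> C * exp (K * x)"
    "\<And>x. x \<ge> 0 \<Longrightarrow> norm (Si x) \<le> C * exp (K * x)"
    by (rule X_bound) blast
  define N where "N = norm (mat 1 :: complex ^ 'n ^ 'n)"
  define N2 where "N2 = norm (mat 1 :: complex ^ ('p + 'p) ^ ('p + 'p))"
  have N: "N \<ge> 0" "N2 \<ge> 0" by (simp_all add: N_def N2_def)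
  have diff: "norm (w x z - mat 1) \<le> C ^ 3 * exp (3 * K * x) * (N / (Im z - norm A))"
    "norm (w' x z - mat 1) \<le> C ^ 3 * exp (3 * K * x) * (N / (Im z - norm A))"
    if "x \<ge> 0" "norm A < Im z" for x z
  proof -
    let ?e = "C * exp (K * x)"
    have e: "?e * ?e * (N / (Im z - norm A)) * ?e = C ^ 3 * exp (3 * K * x) * (N / (Im z - norm A))"
      "?e * (N / (Im z - norm A)) * ?e * ?e = C ^ 3 * exp (3 * K * x) * (N / (Im z - norm A))"
      by (simp_all add: power3_eq_cube mult_ac flip: exp_add)
    have "norm (X x ** Res z ** P x) \<le> ?e * ?e * (N / (Im z - norm A)) * ?e"
      unfolding X_def N_def
      by (intro norm_mat_mult_le resolvent_bound b that) (simp add: b that)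
    then show "norm (w x z - mat 1) \<le> C ^ 3 * exp (3 * K * x) * (N / (Im z - norm A))"
      unfolding e by (simp add: w_def)
    have "norm (Ps x ** Res' z ** Si x ** P x) \<le> ?e * (N / (Im z - norm A)) * ?e * ?e"
      unfolding N_def
      by (intro norm_mat_mult_le resolvent_bound b that) (simp add: b that)
    then show "norm (w' x z - mat 1) \<le> C ^ 3 * exp (3 * K * x) * (N / (Im z - norm A))"
      unfolding e by (simp add: w'_def)
  qed
  have bd: "norm M \<le> (C ^ 3 * N + N2) * exp (3 * K * x)"
    if "x \<ge> 0" "norm A + 1 \<le> Im z" "norm (M - mat 1) \<le> C ^ 3 * exp (3 * K * x) * (N / (Im z - norm A))"
    for M :: "complex ^ ('p + 'p) ^ ('p + 'p)" and x z
  proof -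
    have "norm M \<le> norm (M - mat 1) + N2"
      unfolding N2_def by (metis diff_add_cancel norm_triangle_ineq)
    also have "\<dots> \<le> C ^ 3 * exp (3 * K * x) * (N / (Im z - norm A)) + N2"
      using that by simp
    also have "\<dots> \<le> C ^ 3 * exp (3 * K * x) * N + N2 * exp (3 * K * x)"
    proof (intro add_mono mult_left_mono)
      show "N / (Im z - norm A) \<le> N"
        using that N divide_left_mono[of 1 "Im z - norm A" N] by simp
      show "N2 \<le> N2 * exp (3 * K * x)"
        using N CK that mult_left_mono[of 1 "exp (3 * K * x)" N2] by simp
    qed (use CK in auto)
    finally show ?thesis by (simp add: algebra_simps)
  qed
  show ?thesis
  proof
    show "C ^ 3 * N + N2 \<ge> 0" "3 * K \<ge> 0" using CK N by auto
    show "norm (w x z) \<le> (C ^ 3 * N + N2) * exp (3 * K * x)" "norm (w' x z) \<le> (C ^ 3 * N + N2) * exp (3 * K * x)"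
      if "x \<ge> 0" "norm A + 1 \<le> Im z" for x z
      using that by (auto intro!: bd[of _ z] diff)
    show "norm (w' 0 z - mat 1) \<le> (C ^ 3 * N + N2) / (Im z - norm A)" if "norm A < Im z" for z
    proof -
      have "norm (w' 0 z - mat 1) \<le> C ^ 3 * N / (Im z - norm A)"
        using diff(2)[of 0 z] that by simp
      also have "\<dots> \<le> (C ^ 3 * N + N2) / (Im z - norm A)"
        using that N by (intro divide_right_mono) auto
      finally show ?thesis .
    qed
  qed
qed

end

section \<open>Functions in a half-plane\<close>

text \<open>Multiplying f by e^(-2ilz) gives a bounded function F, whose bound may depend badly on
  l; on an inner horizontal line it is at most B e^(2lm) with B independent of l. Phragmen-Lindelof
  carries this to z0, and l is then taken large.\<close>

lemma half_plane_superexponential_decay: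
  assumes f: "f holomorphic_on half_plane M"
    and decay: "\<And>l. l \<ge> 0 \<Longrightarrow> \<exists>K. \<forall>z\<in>half_plane M. cmod (f z) \<le> K * exp (- 2 * l * Im z)"
    and z0: "z0 \<in> half_plane M"
  shows "f z0 = 0"
proof -
  \<comment> \<open>An intermediate height: the line Im z = m lies inside the open half-plane, and
    z0 lies strictly above it.\<close>
  define m where "m = (M + Im z0) / 2"
  have m: "M < m" "m < Im z0" using z0 by (auto simp: m_def half_plane_def)
  \<comment> \<open>The case l = 0 of the decay provides the bound that does not depend on
    l.\<close>
  obtain B0 where B0: "\<And>z. z \<in> half_plane M \<Longrightarrow> cmod (f z) \<le> B0"
    using decay[of 0] by auto
  define B where "B = max B0 1"
  have B: "B > 0" "\<And>z. z \<in> half_plane M \<Longrightarrow> cmod (f z) \<le> B"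
    using B0 by (auto simp: B_def le_max_iff_disj)
  have claim: "cmod (f z0) * exp (2 * l * (Im z0 - m)) \<le> B" if l: "l \<ge> 0" for l
  proof -
    obtain K where K: "\<And>z. z \<in> half_plane M \<Longrightarrow> cmod (f z) \<le> K * exp (- 2 * l * Im z)"
      using decay[OF l] by blast
    define F where "F z = f z * exp (- 2 * \<i> * of_real l * z)" for z
    have normF: "cmod (F z) = cmod (f z) * exp (2 * l * Im z)" for z
      by (simp add: F_def norm_mult)
    have F_le: "cmod (F z) \<le> K" if "z \<in> half_plane M" for z
    proof -
      have "cmod (F z) \<le> K * exp (- 2 * l * Im z) * exp (2 * l * Im z)"
        unfolding normF using K[OF that] by (intro mult_right_mono) auto
      then show ?thesis by (simp add: mult.assoc flip: exp_add)
    qed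
    define D where "D = B * exp (2 * l * m)"
    have D: "D > 0" using B by (simp add: D_def)
    define u where "u z = z - \<i> * of_real m" for z
    have main: "cmod (F z0) \<le> D * cmod (1 - \<i> * of_real e * u z0)" if e: "e > 0" for e
    proof -
      let ?den = "\<lambda>z. 1 - \<i> * of_real e * u z"
      let ?H = "{z. Im z \<ge> m}"
      \<comment> \<open>Large enough that z0 lies in the disc and that on its boundary circle the
        denominator, of modulus at least eR - 1, outweighs the crude bound K.\<close>
      define R where "R = max (cmod (u z0)) ((\<bar>K\<bar> / D + 1) / e)"
      define T where "T = cball (\<i> * of_real m) R \<inter> ?H"
      have HM: "T \<subseteq> half_plane M"
        using m by (auto simp: T_def half_plane_def)
      have den: "1 \<le> cmod (?den z)" if "m \<le> Im z" for z
      proof -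
        have "1 \<le> Re (?den z)" using that e by (simp add: u_def)
        then show ?thesis using complex_Re_le_cmod[of "?den z"] by linarith
      qed
      have closed: "closed T"
        unfolding T_def by (intro closed_Int closed_cball closed_halfspace_Im_ge)
      have holF: "(\<lambda>z. F z / ?den z) holomorphic_on T"
        unfolding F_def u_def
        by (intro holomorphic_intros holomorphic_on_subset[OF f HM])
          (use den in \<open>force simp: T_def u_def\<close>)
      have "cmod (F z0 / ?den z0) \<le> D"
      proof (rule maximum_modulus_frontier[of "\<lambda>z. F z / ?den z" T D z0])
        show "(\<lambda>z. F z / ?den z) holomorphic_on interior T"
          using holF interior_subset holomorphic_on_subset by blast
        show "continuous_on (closure T) (\<lambda>z. F z / ?den z)"
          using holF closed by (simp add: holomorphic_on_imp_continuous_on)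
        show "bounded T" by (simp add: T_def bounded_Int)
        show "z0 \<in> T"
          using m by (auto simp: T_def R_def u_def dist_norm norm_minus_commute)
        fix z assume z: "z \<in> frontier T"
        then have zT: "z \<in> T" using closed frontier_subset_closed by blast
        then have den1: "1 \<le> cmod (?den z)" by (auto simp: T_def intro!: den)
        have "frontier ?H = {z. Im z = m}"
          using frontier_halfspace_ge[of \<i> m] by (simp add: inner_complex_def)
        then have "dist (\<i> * of_real m) z = R \<or> Im z = m"
          using z frontier_Int_subset[of "cball (\<i> * of_real m) R" ?H] by (auto simp: T_def)
        then show "cmod (F z / ?den z) \<le> D"
        proof
          assume "Im z = m"
          then have "cmod (F z) \<le> D"
            using B(2)[of z] zT HM by (auto simp: normF D_def)
          also have "\<dots> \<le> D * cmod (?den z)" using den1 D by simp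
          finally show ?thesis
            using den1 D by (simp add: norm_divide divide_le_eq)
        next
          assume "dist (\<i> * of_real m) z = R"
          then have "cmod (u z) = R" by (simp add: u_def dist_norm norm_minus_commute)
          then have "e * R - 1 \<le> cmod (?den z)"
            using norm_triangle_ineq2[of "\<i> * of_real e * u z" 1] e by (simp add: norm_mult norm_minus_commute)
          moreover have "\<bar>K\<bar> / D + 1 \<le> e * R"
          proof -
            have "(\<bar>K\<bar> / D + 1) / e \<le> R" by (simp add: R_def)
            then show ?thesis using e by (simp add: divide_le_eq mult.commute)
          qed
          ultimately have "\<bar>K\<bar> / D \<le> cmod (?den z)" by linarith
          then have "\<bar>K\<bar> \<le> D * cmod (?den z)" using D by (simp add: divide_le_eq mult.commute)
          then have "cmod (F z) \<le> D * cmod (?den z)"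
            using F_le[of z] zT HM by auto
          then show ?thesis
            using den1 D by (simp add: norm_divide divide_le_eq)
        qed
      qed
      moreover have "0 < cmod (?den z0)"
        using den[of z0] m by linarith
      ultimately show ?thesis
        by (simp only: norm_divide pos_divide_le_eq)
    qed
    \<comment> \<open>The auxiliary denominator is removed by letting e tend to 0 at the fixed point
      z0.\<close>
    have "((\<lambda>e. D * cmod (1 - \<i> * of_real e * u z0)) \<longlongrightarrow> D * cmod (1 - \<i> * of_real 0 * u z0)) (at_right 0)"
      by (intro tendsto_intros)
    moreover have "\<forall>\<^sub>F e in at_right 0. cmod (F z0) \<le> D * cmod (1 - \<i> * of_real e * u z0)"
      by (auto simp: eventually_at_filter intro!: main always_eventually)
    ultimately have "cmod (F z0) \<le> D * cmod (1 - \<i> * of_real 0 * u z0)"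
      by (rule tendsto_lowerbound) simp
    then have "cmod (f z0) * exp (2 * l * Im z0) \<le> B * exp (2 * l * m)"
      by (simp add: normF D_def)
    then have "cmod (f z0) * (exp (2 * l * (Im z0 - m)) * exp (2 * l * m)) \<le> B * exp (2 * l * m)"
      by (simp add: algebra_simps flip: exp_add)
    then show ?thesis by (simp flip: mult.assoc)
  qed
  show ?thesis
  proof (rule ccontr)
    assume "f z0 \<noteq> 0"
    \<comment> \<open>With 1 + t \<le> e^t this l makes the linear term alone equal to B, which
      leaves no room for |f z0|.\<close>
    define l where "l = B / (cmod (f z0) * (2 * (Im z0 - m)))"
    have "l \<ge> 0" using B m by (simp add: l_def)
    have "cmod (f z0) * (1 + 2 * l * (Im z0 - m)) \<le> cmod (f z0) * exp (2 * l * (Im z0 - m))"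
      by (intro mult_left_mono exp_ge_add_one_self) auto
    also have "\<dots> \<le> B" by (rule claim) fact
    finally have "cmod (f z0) + l * (cmod (f z0) * (2 * (Im z0 - m))) \<le> B"
      by (simp add: algebra_simps)
    moreover have "l * (cmod (f z0) * (2 * (Im z0 - m))) = B"
      using \<open>f z0 \<noteq> 0\<close> m by (simp add: l_def)
    ultimately show False using \<open>f z0 \<noteq> 0\<close> by simp
  qed
qed

section \<open>Holomorphic matrix functions\<close>

lemma matrix_holomorphic_on_subset: "\<lbrakk>matrix_holomorphic_on F D; D' \<subseteq> D\<rbrakk> \<Longrightarrow> matrix_holomorphic_on F D'"
  unfolding matrix_holomorphic_on_def using holomorphic_on_subset by blast

lemma matrix_holomorphic_const: "matrix_holomorphic_on (\<lambda>z. B) D"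
  and matrix_holomorphic_add: "\<lbrakk>matrix_holomorphic_on F D; matrix_holomorphic_on G D\<rbrakk> \<Longrightarrow> matrix_holomorphic_on (\<lambda>z. F z + G z) D"
  and matrix_holomorphic_diff: "\<lbrakk>matrix_holomorphic_on F D; matrix_holomorphic_on G D\<rbrakk> \<Longrightarrow> matrix_holomorphic_on (\<lambda>z. F z - G z) D"
  and matrix_holomorphic_smult: "\<lbrakk>k holomorphic_on D; matrix_holomorphic_on F D\<rbrakk> \<Longrightarrow> matrix_holomorphic_on (\<lambda>z. k z *\<^sub>C F z) D"
  by (auto simp: matrix_holomorphic_on_def intro!: holomorphic_intros)

lemma matrix_holomorphic_mult:
  assumes "matrix_holomorphic_on F D" "matrix_holomorphic_on G D"
  shows "matrix_holomorphic_on (\<lambda>z. F z ** G z) D"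
  using assms by (auto simp: matrix_holomorphic_on_def mat_mult_nth intro!: holomorphic_intros)

lemma holomorphic_on_det:
  fixes F :: "complex \<Rightarrow> complex ^ 'n ^ 'n"
  assumes "\<And>i j. (\<lambda>z. F z $ i $ j) holomorphic_on D"
  shows "(\<lambda>z. det (F z)) holomorphic_on D"
  unfolding det_def by (intro holomorphic_intros assms)

text \<open>Cramer's rule: an entry of the inverse is a quotient of determinants, with column k
  replaced by the j-th unit vector in the numerator.\<close>

lemma matrix_holomorphic_inv:
  fixes F :: "complex \<Rightarrow> complex ^ 'n ^ 'n"
  assumes F: "matrix_holomorphic_on F D"
    and inv: "\<And>z. z \<in> D \<Longrightarrow> F z ** matrix_inv (F z) = mat 1"
  shows "matrix_holomorphic_on (\<lambda>z. matrix_inv (F z)) D"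
  unfolding matrix_holomorphic_on_def
proof (intro allI)
  fix k j
  have det: "det (F z) \<noteq> 0" if "z \<in> D" for z
    using det_mul[of "F z" "matrix_inv (F z)"] by (auto simp: inv[OF that])
  let ?G = "\<lambda>z. (\<chi> i l. if l = k then axis j 1 $ i else F z $ i $ l) :: complex ^ 'n ^ 'n"
  have "matrix_inv (F z) $ k $ j = det (?G z) / det (F z)" if "z \<in> D" for z
  proof -
    have "F z *v column j (matrix_inv (F z)) = axis j 1"
    proof -
      have "(F z *v column j (matrix_inv (F z))) $ i = (F z ** matrix_inv (F z)) $ i $ j" for i
        by (simp add: matrix_vector_mult_def mat_mult_nth column_def)
      then show ?thesis by (simp add: vec_eq_iff inv[OF that] mat_def axis_def)
    qed
    then have "column j (matrix_inv (F z)) $ k = det (?G z) / det (F z)"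
      using cramer[OF det[OF that]] by simp
    then show ?thesis by (simp add: column_def)
  qed
  note eq = this
  have "(\<lambda>z. ?G z $ i $ l) holomorphic_on D" for i l
    using F unfolding matrix_holomorphic_on_def by (cases "l = k") auto
  then have "(\<lambda>z. det (?G z) / det (F z)) holomorphic_on D"
    using F det unfolding matrix_holomorphic_on_def
    by (intro holomorphic_intros holomorphic_on_det) auto
  then show "(\<lambda>z. matrix_inv (F z) $ k $ j) holomorphic_on D"
    by (rule holomorphic_transform) (simp add: eq)
qed

text \<open>The squared Frobenius norm is the trace of the Gram matrix. It passes from the matrix
  integrand of a Weyl function to the size of the solution.\<close>

lemma norm_sq_le_norm_gram: "(norm Z)\<^sup>2 \<le> norm (mat 1 :: complex ^ 'q ^ 'q) * norm (cadjoint Z ** Z)"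
  for Z :: "complex ^ 'q ^ 'm"
proof -
  have "(norm Z)\<^sup>2 = inner (mat 1) (cadjoint Z ** Z)"
    using inner_mat_cadjoint[of Z "mat 1" Z] by (simp add: power2_norm_eq_inner)
  also have "\<dots> \<le> norm (mat 1 :: complex ^ 'q ^ 'q) * norm (cadjoint Z ** Z)"
    by (rule norm_cauchy_schwarz)
  finally show ?thesis .
qed

section \<open>Integrability on the half-line\<close>

lemma not_integrable_bounded_below:
  fixes F :: "real \<Rightarrow> 'a :: {banach, second_countable_topology}"
  assumes F: "set_integrable lborel {0..} F" and "d > 0" "x0 \<ge> 0"
    and lower: "\<And>x. x \<ge> x0 \<Longrightarrow> d \<le> norm (F x)"
  shows False
proof -
  have "set_integrable lborel {x0..} F"
    by (rule set_integrable_subset[OF F]) (use \<open>x0 \<ge> 0\<close> in auto)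
  then have "set_integrable lborel {x0..} (\<lambda>x. d)"
    by (rule set_integrable_bound)
      (use lower \<open>d > 0\<close> in \<open>auto simp: set_borel_measurable_def\<close>)
  then have "integrable lborel (\<lambda>x. d * indicator {x0..} x)"
    by (simp add: set_integrable_def mult.commute)
  then have "integrable lborel (indicator {x0..} :: real \<Rightarrow> real)"
    using \<open>d > 0\<close> by simp
  then have fin: "emeasure lborel {x0..} < \<infinity>"
    by (simp add: integrable_indicator_iff)
  then obtain r where r: "r \<ge> 0" "emeasure lborel {x0..} = ennreal r"
    by (cases "emeasure lborel {x0..}") auto
  \<comment> \<open>A bounded interval already longer than the supposed finite measure r.\<close>
  have "emeasure lborel {x0..x0 + (r + 1)} \<le> emeasure lborel {x0..}"
    by (intro emeasure_mono) auto
  then show False using r by simp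
qed

lemma set_integrable_exp_decay:
  fixes F :: "real \<Rightarrow> 'a :: {banach, second_countable_topology}"
  assumes cont: "continuous_on {0..} F" and "d > 0"
    and upper: "\<And>x. x \<ge> 0 \<Longrightarrow> norm (F x) \<le> C * exp (- d * x)"
  shows "set_integrable lborel {0..} F"
proof (rule set_integrable_bound)
  have "(\<lambda>x. exp (- d * x)) absolutely_integrable_on {0..}"
    by (intro nonnegative_absolutely_integrable_1 integrable_on_exp_minus_to_infinity) (use \<open>d > 0\<close> in auto)
  then have "set_integrable lborel {0..} (\<lambda>x. exp (- d * x))"
    unfolding set_integrable_def
    \<comment> \<open>Passes from the completed Lebesgue measure of the gauge integral to
      \<open>lborel\<close>.\<close>
    by (subst (asm) integrable_completion) auto
  then show "set_integrable lborel {0..} (\<lambda>x. C * exp (- d * x))"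
    by simp
  show "set_borel_measurable lborel {0..} F"
    unfolding set_borel_measurable_def using borel_measurable_continuous_on_indicator[OF _ cont] by simp
  show "AE x in lborel. x \<in> {0..} \<longrightarrow> norm (F x) \<le> norm (C * exp (- d * x))"
    using upper by (intro always_eventually) (auto intro: order_trans[OF _ abs_ge_self])
qed

text \<open>Only the two exponential bounds are used, not the construction of \<phi>. That
  \<open>K\<close> does not depend on z is essential twice: it makes the GW supremum finite over the
  whole half-plane, and it makes the decay in the uniqueness proof uniform.\<close>

theorem weyl_GW_of_exponential_dichotomy:
  fixes V :: "real \<Rightarrow> complex ^ ('p::finite + 'p) ^ ('p + 'p)" and \<phi> :: "complex \<Rightarrow> complex ^ 'p ^ 'p"
  assumes V: "\<And>l. bounded (V ` {0..l})"
    and holo: "matrix_holomorphic_on \<phi> (half_plane M)"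
    and cont: "\<And>z. M < Im z \<Longrightarrow> continuous_on {0..} (\<lambda>x. dirac_W V x z)"
    and upper: "\<And>x z. \<lbrakk>0 \<le> x; M < Im z\<rbrakk> \<Longrightarrow>
      norm (dirac_W V x z ** vcat (mat 1) (\<phi> z)) \<le> C * exp ((K - Im z) * x)"
    and "k > 0"
    and lower: "\<And>x z g. \<lbrakk>0 \<le> x; M < Im z\<rbrakk> \<Longrightarrow>
      k * norm g * exp ((Im z - K) * x) \<le> norm (dirac_W V x z ** vcat 0 (g :: complex ^ 'p ^ 'p))"
  shows "weyl_function V \<phi> \<and> GW_function V \<phi> \<and>
    (\<forall>\<psi>. weyl_function V \<psi> \<or> GW_function V \<psi> \<longrightarrow> (\<exists>M>0. \<forall>z\<in>half_plane M. \<psi> z = \<phi> z))"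
proof -
  \<comment> \<open>Above \<open>K\<close> the upper bound decays in x; the 1 keeps the threshold
    positive.\<close>
  define M0 where "M0 = max M (max K 1)"
  have M0: "M0 > 0" "M \<le> M0" "K \<le> M0" by (auto simp: M0_def)
  have C: "C \<ge> 0"
    using order_trans[OF norm_ge_zero upper[of 0 "\<i> * of_real (M + 1)"]] by simp
  let ?Z = "\<lambda>\<psi> x z. dirac_W V x z ** vcat (mat 1) (\<psi> z)"
  have gram: "hcat (mat 1) (cadjoint (\<psi> z)) ** cadjoint (dirac_W V x z) ** dirac_W V x z ** vcat (mat 1) (\<psi> z) =
      cadjoint (?Z \<psi> x z) ** ?Z \<psi> x z" for \<psi> :: "complex \<Rightarrow> complex ^ 'p ^ 'p" and x z
    by (simp add: cadjoint_mult cadjoint_vcat matrix_mul_assoc)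
  have holo0: "matrix_holomorphic_on \<phi> (half_plane M0)"
    by (rule matrix_holomorphic_on_subset[OF holo]) (use M0 in \<open>auto simp: half_plane_def\<close>)
  have weyl: "weyl_function V \<phi>"
    unfolding weyl_function_def
  proof (intro exI[of _ M0] conjI ballI holo0 M0(1))
    fix z assume "z \<in> half_plane M0"
    then have z: "M < Im z" "K < Im z" using M0 by (auto simp: half_plane_def)
    show "set_integrable lborel {0..} (\<lambda>x. hcat (mat 1) (cadjoint (\<phi> z)) ** cadjoint (dirac_W V x z)
        ** dirac_W V x z ** vcat (mat 1) (\<phi> z))"
      unfolding gram
    proof (rule set_integrable_exp_decay)
      show "continuous_on {0..} (\<lambda>x. cadjoint (?Z \<phi> x z) ** ?Z \<phi> x z)"
        by (intro bounded_bilinear.continuous_on[OF bounded_bilinear_mat_mult]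
            bounded_linear.continuous_on[OF bounded_linear_cadjoint] cont z continuous_on_const)
      show "2 * (Im z - K) > 0" using z by simp
      show "norm (cadjoint (?Z \<phi> x z) ** ?Z \<phi> x z) \<le> C\<^sup>2 * exp (- (2 * (Im z - K)) * x)" if "x \<ge> 0" for x
      proof -
        have "norm (cadjoint (?Z \<phi> x z) ** ?Z \<phi> x z) \<le> C * exp ((K - Im z) * x) * (C * exp ((K - Im z) * x))"
          using upper[OF that z(1)] by (intro norm_mat_mult_le[of "cadjoint _"]) simp_all
        also have "\<dots> = C\<^sup>2 * exp (- (2 * (Im z - K)) * x)"
          by (simp add: power2_eq_square mult_ac flip: exp_add)
        finally show ?thesis .
      qed
    qed
  qed
  have norm_exp: "norm (exp (- \<i> * z * of_real x) *\<^sub>C Z) = exp (Im z * x) * norm Z" for z x and Z :: "complex ^ 'p ^ ('p + 'p)"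
    by simp
  have GW: "GW_function V \<phi>"
    unfolding GW_function_def
  proof (rule conjI, intro allI V, rule exI[of _ M0], intro conjI allI holo0 M0(1))
    fix l
    show "\<exists>B. \<forall>x\<in>{0..l}. \<forall>z\<in>half_plane M0. norm (exp (- \<i> * z * of_real x) *\<^sub>C ?Z \<phi> x z) \<le> B"
    proof (intro exI ballI)
      fix x z assume x: "x \<in> {0..l}" and "z \<in> half_plane M0"
      then have z: "M < Im z" using M0 by (auto simp: half_plane_def)
      have "exp (Im z * x) * norm (?Z \<phi> x z) \<le> exp (Im z * x) * (C * exp ((K - Im z) * x))"
        using upper[OF _ z, of x] x by (intro mult_left_mono) auto
      also have "\<dots> = C * exp (K * x)"
        by (simp add: mult_ac flip: exp_add) (simp add: algebra_simps)
      also have "\<dots> \<le> C * exp (\<bar>K\<bar> * l)"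
        using x C by (intro mult_exp_mono) auto
      finally show "norm (exp (- \<i> * z * of_real x) *\<^sub>C ?Z \<phi> x z) \<le> C * exp (\<bar>K\<bar> * l)"
        unfolding norm_exp .
    qed
  qed
  \<comment> \<open>Two candidates differ by a solution starting in [0; g], which must grow unless g
    = 0.\<close>
  have diff: "dirac_W V x z ** vcat 0 (\<psi> z - \<phi> z) = ?Z \<psi> x z - ?Z \<phi> x z"
    for \<psi> :: "complex \<Rightarrow> complex ^ 'p ^ 'p" and x z
    by (simp add: block_simps flip: mat_mult_diff)
  have lower': "k * norm (\<psi> z - \<phi> z) * exp ((Im z - K) * x) \<le> norm (?Z \<psi> x z) + C * exp ((K - Im z) * x)"
    if "0 \<le> x" "M < Im z" for \<psi> :: "complex \<Rightarrow> complex ^ 'p ^ 'p" and x z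
    using lower[OF that, of "\<psi> z - \<phi> z"] upper[OF that] norm_triangle_ineq4[of "?Z \<psi> x z" "?Z \<phi> x z"]
    unfolding diff by linarith
  have weyl_unique: "\<exists>M>0. \<forall>z\<in>half_plane M. \<psi> z = \<phi> z" if "weyl_function V \<psi>" for \<psi>
  proof -
    obtain M' where *: "M' > 0 \<and> matrix_holomorphic_on \<psi> (half_plane M') \<and>
        (\<forall>z\<in>half_plane M'. set_integrable lborel {0..} (\<lambda>x. cadjoint (?Z \<psi> x z) ** ?Z \<psi> x z))"
      using \<open>weyl_function V \<psi>\<close> unfolding weyl_function_def gram by (rule exE)
    note M' = *[THEN conjunct1] and int = *[THEN conjunct2, THEN conjunct2, rule_format]
    have "\<psi> z = \<phi> z" if "z \<in> half_plane (max M' M0)" for z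
    proof (rule ccontr)
      assume "\<psi> z \<noteq> \<phi> z"
      have z: "M < Im z" "K < Im z" "z \<in> half_plane M'"
        using that M0 by (auto simp: half_plane_def)
      define d where "d = k * norm (\<psi> z - \<phi> z)"
      have d: "d > 0" using \<open>\<psi> z \<noteq> \<phi> z\<close> \<open>k > 0\<close> by (simp add: d_def)
      \<comment> \<open>By 1 + t \<le> e^t the growing side is at least C + 1 from x0 on;
        subtracting the contribution of \<phi>, at most C, leaves 1.\<close>
      define x0 where "x0 = (C + 1) / (d * (Im z - K))"
      define N where "N = norm (mat 1 :: complex ^ 'p ^ 'p)"
      have x0: "x0 \<ge> 0" using C d z by (simp add: x0_def)
      have one: "1 \<le> norm (?Z \<psi> x z)" if "x \<ge> x0" for x
      proof -
        have "C + 1 = d * (Im z - K) * x0" using d z by (simp add: x0_def)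
        also have "\<dots> \<le> d * (Im z - K) * x" using that d z by (intro mult_left_mono) auto
        also have "\<dots> \<le> d * exp ((Im z - K) * x)"
          unfolding mult.assoc using d exp_ge_add_one_self[of "(Im z - K) * x"] by (intro mult_left_mono) linarith+
        also have "\<dots> \<le> norm (?Z \<psi> x z) + C * exp ((K - Im z) * x)"
          using lower'[of x z \<psi>] z x0 that by (simp add: d_def)
        also have "C * exp ((K - Im z) * x) \<le> C * 1"
          using z x0 that C by (intro mult_left_mono) (auto simp: mult_nonpos_nonneg)
        finally show ?thesis by simp
      qed
      have "1 / (N + 1) \<le> norm (cadjoint (?Z \<psi> x z) ** ?Z \<psi> x z)" if "x \<ge> x0" for x
      proof -
        have "1 \<le> (norm (?Z \<psi> x z))\<^sup>2" using one[OF that] by simp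
        also have "\<dots> \<le> N * norm (cadjoint (?Z \<psi> x z) ** ?Z \<psi> x z)"
          unfolding N_def by (rule norm_sq_le_norm_gram)
        also have "\<dots> \<le> (N + 1) * norm (cadjoint (?Z \<psi> x z) ** ?Z \<psi> x z)"
          by (intro mult_right_mono) auto
        finally show ?thesis
          by (simp add: N_def divide_le_eq mult.commute add_nonneg_pos)
      qed
      from not_integrable_bounded_below[OF int[OF z(3)] _ x0 this] show False
        by (simp add: N_def add_nonneg_pos)
    qed
    then show ?thesis using M' by (intro exI[of _ "max M' M0"]) auto
  qed
  have GW_unique: "\<exists>M>0. \<forall>z\<in>half_plane M. \<psi> z = \<phi> z" if "GW_function V \<psi>" for \<psi>
  proof -
    obtain M' where *: "M' > 0 \<and> matrix_holomorphic_on \<psi> (half_plane M') \<and>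
        (\<forall>l. \<exists>B. \<forall>x\<in>{0..l}. \<forall>z\<in>half_plane M'. norm (exp (- \<i> * z * of_real x) *\<^sub>C ?Z \<psi> x z) \<le> B)"
      using \<open>GW_function V \<psi>\<close>[unfolded GW_function_def, THEN conjunct2] by (rule exE)
    note M' = *[THEN conjunct1] *[THEN conjunct2, THEN conjunct1]
      and bound = *[THEN conjunct2, THEN conjunct2, THEN spec]
    define M1 where "M1 = max M' M0"
    have sub: "half_plane M1 \<subseteq> half_plane M'" "half_plane M1 \<subseteq> half_plane M0"
      by (auto simp: half_plane_def M1_def)
    have holo_diff: "(\<lambda>z. (\<psi> z - \<phi> z) $ i $ j) holomorphic_on half_plane M1" for i j
      using matrix_holomorphic_diff[OF matrix_holomorphic_on_subset[OF M'(2) sub(1)] matrix_holomorphic_on_subset[OF holo0 sub(2)]]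
      by (simp only: matrix_holomorphic_on_def)
    have decay: "\<exists>B. \<forall>z\<in>half_plane M1. norm (\<psi> z - \<phi> z) \<le> B * exp (- 2 * l * Im z)" if l: "l \<ge> 0" for l
    proof -
      obtain B where "\<forall>x\<in>{0..l}. \<forall>z\<in>half_plane M'. norm (exp (- \<i> * z * of_real x) *\<^sub>C ?Z \<psi> x z) \<le> B"
        using bound[of l] by (rule exE)
      then have "\<forall>z\<in>half_plane M'. norm (exp (- \<i> * z * of_real l) *\<^sub>C ?Z \<psi> l z) \<le> B"
        by (rule bspec) (use l in simp)
      note B = bspec[OF this]
      \<comment> \<open>Only x = l is used: the GW bound gives a factor e^(-l Im z) and the lower
        bound supplies a second one.\<close>
      have "norm (\<psi> z - \<phi> z) \<le> (B + C * exp (K * l)) * exp (K * l) / k * exp (- 2 * l * Im z)" if "z \<in> half_plane M1" for z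
      proof -
        have z: "z \<in> half_plane M'" "M < Im z"
          using that sub M0 by (auto simp: half_plane_def)
        have "exp (Im z * l) * (k * norm (\<psi> z - \<phi> z) * exp ((Im z - K) * l)) \<le>
            exp (Im z * l) * (norm (?Z \<psi> l z) + C * exp ((K - Im z) * l))"
          by (intro mult_left_mono lower' \<open>l \<ge> 0\<close> z) simp
        also have "\<dots> = norm (exp (- \<i> * z * of_real l) *\<^sub>C ?Z \<psi> l z) + C * exp (K * l)"
          unfolding norm_exp by (simp add: algebra_simps flip: exp_add)
        also have "\<dots> \<le> B + C * exp (K * l)"
          using B[OF z(1)] by simp
        finally have "exp (Im z * l) * (k * norm (\<psi> z - \<phi> z) * exp ((Im z - K) * l)) * (exp (K * l) * exp (- 2 * l * Im z)) \<le>
            (B + C * exp (K * l)) * (exp (K * l) * exp (- 2 * l * Im z))"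
          by (rule mult_right_mono) simp
        moreover have "exp (Im z * l) * (k * norm (\<psi> z - \<phi> z) * exp ((Im z - K) * l)) * (exp (K * l) * exp (- 2 * l * Im z)) =
            k * norm (\<psi> z - \<phi> z) * exp (Im z * l + (Im z - K) * l + K * l + - 2 * l * Im z)"
          by (simp only: exp_add mult_ac)
        moreover have "Im z * l + (Im z - K) * l + K * l + - 2 * l * Im z = 0"
          by (simp add: algebra_simps)
        ultimately have "k * norm (\<psi> z - \<phi> z) \<le> (B + C * exp (K * l)) * (exp (K * l) * exp (- 2 * l * Im z))"
          by (simp only: exp_zero mult.right_neutral)
        then have "norm (\<psi> z - \<phi> z) \<le> (B + C * exp (K * l)) * (exp (K * l) * exp (- 2 * l * Im z)) / k"
          using \<open>k > 0\<close> by (simp add: pos_le_divide_eq mult.commute)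
        then show ?thesis by (simp only: times_divide_eq_left mult.assoc)
      qed
      then show ?thesis by blast
    qed
    have "\<psi> z = \<phi> z" if "z \<in> half_plane M1" for z
    proof -
      have "(\<psi> z - \<phi> z) $ i $ j = 0" for i j
      proof (rule half_plane_superexponential_decay[OF holo_diff _ that])
        fix l :: real assume "l \<ge> 0"
        from decay[OF this] obtain B where B: "\<forall>z\<in>half_plane M1. norm (\<psi> z - \<phi> z) \<le> B * exp (- 2 * l * Im z)"
          by (rule exE)
        show "\<exists>B. \<forall>z\<in>half_plane M1. cmod ((\<psi> z - \<phi> z) $ i $ j) \<le> B * exp (- 2 * l * Im z)"
          by (intro exI[of _ B] ballI order_trans[OF norm_mat_nth] B[rule_format])
      qed
      then show ?thesis by (simp add: vec_eq_iff)
    qed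
    then show ?thesis using M' by (intro exI[of _ M1]) (auto simp: M1_def)
  qed
  show ?thesis
    by (intro conjI weyl GW allI impI) (elim disjE weyl_unique GW_unique)
qed

section \<open>The exponential seed\<close>

text \<open>The matrix Q and the vectors f1 to f4 are absent here: they enter only through the
  differential equation of P. The matrices \<open>L1\<close> and \<open>L2\<close> stand for
  \<Lambda>1(0) and \<Lambda>2(0).\<close>

locale exponential_seed = gbdt A P S V b
  for A :: "complex ^ 'n ^ 'n" and P :: "real \<Rightarrow> complex ^ ('p::finite + 'p) ^ 'n" and S V b +
  fixes a :: complex and c :: real and L1 L2 :: "complex ^ 'p ^ 'n"
  assumes a_nz: "a \<noteq> 0"
    and V_blk: "V x = blk 0 (a * exp (2 * \<i> * of_real c * of_real x)) (cnj a * exp (- (2 * \<i> * of_real c * of_real x))) 0"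
    and P_0: "P 0 = hcat L1 L2"
begin

section \<open>The root \<zeta> and the seed system\<close>

abbreviation "\<zeta> z \<equiv> zeta_branch a c z"
definition "h z = z - of_real c - \<zeta> z"

lemma Im_zeta_pos: "cmod a < Im z \<Longrightarrow> 0 < Im (\<zeta> z)"
  by (intro zeta_branch_upper) (auto intro: le_less_trans[OF norm_ge_zero])

lemma h_sum: "h z * (z - of_real c + \<zeta> z) = - (a * cnj a)"
proof -
  have "(z - of_real c)\<^sup>2 - (\<zeta> z)\<^sup>2 = - of_real ((cmod a)\<^sup>2)"
    by (simp add: zeta_branch_square)
  then show ?thesis
    by (simp only: complex_norm_square h_def) (simp add: power2_eq_square algebra_simps)
qed

text \<open>In \<open>h_sum\<close> the second factor has imaginary part at least |a|, because the
  branch keeps \<zeta> in the upper half-plane; so the first has modulus at most |a|. This controls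
  Im \<zeta> from below and bounds h/(ia) by 1.\<close>

lemma cmod_h: "cmod (h z) \<le> cmod a" if "cmod a < Im z"
proof -
  have "cmod a \<le> Im (z - of_real c + \<zeta> z)"
    using that Im_zeta_pos[OF that] by simp
  also have "\<dots> \<le> cmod (z - of_real c + \<zeta> z)"
    using abs_Im_le_cmod[of "z - of_real c + \<zeta> z"] by linarith
  finally have "cmod (h z) * cmod a \<le> cmod (h z) * cmod (z - of_real c + \<zeta> z)"
    by (rule mult_left_mono) simp
  also have "\<dots> = cmod a * cmod a"
    by (metis h_sum norm_mult norm_minus_cancel complex_mod_cnj)
  finally show ?thesis using a_nz by simp
qed

lemma Im_zeta: "Im z - cmod a \<le> Im (\<zeta> z)" if "cmod a < Im z"
  using cmod_h[OF that] abs_Im_le_cmod[of "h z"] by (simp add: h_def)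

text \<open>\<open>ch\<close> is cos(\<zeta> x) and \<open>sh\<close> is sin(\<zeta> x)/\<zeta>;
  thus ch' = -\<zeta>^2 sh and sh' = ch.\<close>

definition "ch x z = (exp (\<i> * \<zeta> z * of_real x) + exp (- \<i> * \<zeta> z * of_real x)) / 2"
definition "sh x z = (exp (\<i> * \<zeta> z * of_real x) - exp (- \<i> * \<zeta> z * of_real x)) / (2 * \<i> * \<zeta> z)"
definition "ec x = exp (\<i> * of_real c * of_real x)"

lemma ec_inverse: "exp (- \<i> * of_real c * of_real x) = 1 / ec x" "ec x \<noteq> 0" "cmod (ec x) = 1"
  by (simp_all add: ec_def exp_minus field_simps)

text \<open>
  Conjugating by \<open>e^(icxj)\<close> makes the seed system autonomous, with coefficient matrix of square
  \<open>-\<zeta>\<^sup>2\<close>; its exponential is \<open>ch + sh * G\<close>.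
\<close>

definition W0 :: "real \<Rightarrow> complex \<Rightarrow> complex ^ ('p + 'p) ^ ('p + 'p)" where
  "W0 x z = blk (ec x * (ch x z + \<i> * (z - of_real c) * sh x z)) (ec x * (a * sh x z))
  (- (cnj a * sh x z) / ec x) ((ch x z - \<i> * (z - of_real c) * sh x z) / ec x)"

lemma ch_sh_exp:
  assumes "cmod a < Im z"
  shows "ch x z + \<i> * \<zeta> z * sh x z = exp (\<i> * \<zeta> z * of_real x)"
    and "ch x z - \<i> * \<zeta> z * sh x z = exp (- \<i> * \<zeta> z * of_real x)"
proof -
  have "\<zeta> z \<noteq> 0" using Im_zeta_pos[OF assms] by auto
  then have "\<i> * \<zeta> z * sh x z = (exp (\<i> * \<zeta> z * of_real x) - exp (- \<i> * \<zeta> z * of_real x)) / 2"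
    by (simp add: sh_def)
  then show "ch x z + \<i> * \<zeta> z * sh x z = exp (\<i> * \<zeta> z * of_real x)"
    and "ch x z - \<i> * \<zeta> z * sh x z = exp (- \<i> * \<zeta> z * of_real x)"
    by (simp_all add: ch_def field_simps)
qed

lemma ch_sh_deriv:
  assumes "cmod a < Im z"
  shows "((\<lambda>x. ch x z) has_vector_derivative - (\<zeta> z)\<^sup>2 * sh x z) (at x within T)"
    and "((\<lambda>x. sh x z) has_vector_derivative ch x z) (at x within T)"
proof -
  have "\<zeta> z \<noteq> 0" using Im_zeta_pos[OF assms] by auto
  note nz = this
  show "((\<lambda>x. ch x z) has_vector_derivative - (\<zeta> z)\<^sup>2 * sh x z) (at x within T)"
    unfolding ch_def sh_def
    by (rule has_vector_derivative_eq_rhs[OF has_vector_derivative_divide[OF has_vector_derivative_add[OF exp_ix_deriv exp_ix_deriv]]])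
      (use nz in \<open>simp add: field_simps power2_eq_square\<close>)
  show "((\<lambda>x. sh x z) has_vector_derivative ch x z) (at x within T)"
    unfolding ch_def sh_def
    by (rule has_vector_derivative_eq_rhs[OF has_vector_derivative_divide[OF has_vector_derivative_diff[OF exp_ix_deriv exp_ix_deriv]]])
      (use nz in \<open>simp add: field_simps\<close>)
qed

lemma ec_deriv:
  "(ec has_vector_derivative \<i> * of_real c * ec x) (at x within T)"
  "((\<lambda>x. 1 / ec x) has_vector_derivative - (\<i> * of_real c * (1 / ec x))) (at x within T)"
  using exp_ix_deriv[of "\<i> * of_real c" x T] exp_ix_deriv[of "- \<i> * of_real c" x T]
  unfolding ec_inverse(1)[symmetric] by (simp_all add: ec_def[abs_def])

lemma W0_0: "cmod a < Im z \<Longrightarrow> W0 0 z = mat 1"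
  by (simp add: W0_def ch_def sh_def ec_def mat_one_blk)

lemma W0_deriv:
  assumes "cmod a < Im z"
  shows "((\<lambda>x. W0 x z) has_vector_derivative ((\<i> * z) *\<^sub>C jmat + jmat ** V x) ** W0 x z) (at x within T)"
proof -
  have sq: "(\<zeta> z)\<^sup>2 = (z - of_real c)\<^sup>2 + a * cnj a"
    by (simp only: zeta_branch_square complex_norm_square)
  note d = ch_sh_deriv[OF assms, unfolded sq]
  have V: "V x = blk 0 (a * (ec x)\<^sup>2) (cnj a * (1 / ec x)\<^sup>2) 0" for x
  proof -
    have "exp (2 * \<i> * of_real c * of_real x) = (ec x)\<^sup>2"
      unfolding ec_def exp_double[symmetric] by (simp add: mult.assoc)
    moreover have "exp (- (2 * \<i> * of_real c * of_real x)) = (1 / ec x)\<^sup>2"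
      unfolding ec_inverse(1)[symmetric] exp_double[symmetric] by (simp add: mult.assoc)
    ultimately show ?thesis by (simp add: V_blk)
  qed
  have W0: "W0 x z = blk (ec x * (ch x z + \<i> * (z - of_real c) * sh x z)) (ec x * (a * sh x z))
    ((1 / ec x) * (- (cnj a * sh x z))) ((1 / ec x) * (ch x z - \<i> * (z - of_real c) * sh x z))" for x
    by (simp add: W0_def)
  show ?thesis
    unfolding W0
    by (rule has_vector_derivative_eq_rhs[OF blk_has_vector_derivative[OF
            has_vector_derivative_mult[OF ec_deriv(1) has_vector_derivative_add[OF d(1) has_vector_derivative_mult_right[OF d(2)]]]
            has_vector_derivative_mult[OF ec_deriv(1) has_vector_derivative_mult_right[OF d(2)]]
            has_vector_derivative_mult[OF ec_deriv(2) has_vector_derivative_minus[OF has_vector_derivative_mult_right[OF d(2)]]]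
            has_vector_derivative_mult[OF ec_deriv(2) has_vector_derivative_diff[OF d(1) has_vector_derivative_mult_right[OF d(2)]]]]])
      (simp add: V jmat_blk blk_mult blk_add smult_blk, rule blk_cong; simp add: ec_inverse(2) field_simps power2_eq_square)
qed

text \<open>The decaying direction of the seed: [I; \<phi>0] belongs to the eigenvalue i\<zeta> of
  the autonomous system.\<close>

definition "\<phi>0 z = h z / (\<i> * a)"
text \<open>Block row belonging to the eigenvalue -i\<zeta>, with the oscillation put back. At x = 0
  it annihilates [I; \<phi>0], so it sees only the growing part.\<close>

definition "L x z = hcat ((\<i> * h z / (a * ec x)) *\<^sub>C mat 1) (ec x *\<^sub>C (mat 1 :: complex ^ 'p ^ 'p))"

text \<open>Eliminates the conjugate of a, after which the eigenvector identities are rational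
  identities in h and \<zeta>.\<close>

lemma h_relations: "cnj a = - (h z * (z - of_real c + \<zeta> z) / a)"
  using a_nz by (simp add: h_sum)

lemma W0_decaying: "W0 x z ** vcat (mat 1) (\<phi>0 z *\<^sub>C mat 1) =
    exp (\<i> * \<zeta> z * of_real x) *\<^sub>C vcat (ec x *\<^sub>C mat 1) ((\<phi>0 z / ec x) *\<^sub>C mat 1)" if "cmod a < Im z"
proof -
  have "ec x * (ch x z + \<i> * (z - of_real c) * sh x z) * 1 + ec x * (a * sh x z) * \<phi>0 z = (ch x z + \<i> * \<zeta> z * sh x z) * ec x"
    using a_nz by (simp add: \<phi>0_def h_def field_simps)
  moreover have "- (cnj a * sh x z) / ec x * 1 + (ch x z - \<i> * (z - of_real c) * sh x z) / ec x * \<phi>0 z =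
      (ch x z + \<i> * \<zeta> z * sh x z) * (\<phi>0 z / ec x)"
    unfolding h_relations[of z] using a_nz ec_inverse(2)[of x] by (simp add: \<phi>0_def field_simps)
  ultimately show ?thesis
    using blk_mult_vcat[where r = 1 and s = "\<phi>0 z" and ?'a = 'p]
    by (simp only: W0_def smult_mat_one ch_sh_exp[OF that] smult_vcat smult_mat_smult)
qed

lemma L_W0: "L x z ** W0 x z = exp (- \<i> * \<zeta> z * of_real x) *\<^sub>C L 0 z" if "cmod a < Im z"
proof -
  have ec0: "ec 0 = 1" by (simp add: ec_def)
  have "\<i> * h z / (a * ec x) * (ec x * (ch x z + \<i> * (z - of_real c) * sh x z)) + ec x * (- (cnj a * sh x z) / ec x) =
      (ch x z - \<i> * \<zeta> z * sh x z) * (\<i> * h z / (a * ec 0))"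
    unfolding h_relations[of z] using a_nz ec_inverse(2)[of x] by (simp add: ec0 field_simps)
  moreover have "\<i> * h z / (a * ec x) * (ec x * (a * sh x z)) + ec x * ((ch x z - \<i> * (z - of_real c) * sh x z) / ec x) =
      (ch x z - \<i> * \<zeta> z * sh x z) * ec 0"
    using a_nz ec_inverse(2)[of x] by (simp add: ec0 h_def field_simps)
  ultimately show ?thesis
    by (simp only: L_def W0_def hcat_mult_blk ch_sh_exp[OF that] smult_hcat smult_mat_smult)
qed

text \<open>Subtracting the conjugate by \<open>jmat\<close> cancels the diagonal blocks of
  \<open>X x ** P x\<close> and doubles the others, whence the factor 2 in the transformed
  potential.\<close>

definition "Vt x = V x + (X x ** P x - jmat ** X x ** P x ** jmat)"
definition "Wt x z = w x z ** W0 x z ** w' 0 z"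

lemma Vt_bounded: "bounded (Vt ` {0..l})"
proof -
  obtain C K where CK: "C \<ge> 0" "K \<ge> 0" and b: "\<And>x. x \<ge> 0 \<Longrightarrow> norm (P x) \<le> C * exp (K * x)"
    "\<And>x. x \<ge> 0 \<Longrightarrow> norm (Si x) \<le> C * exp (K * x)"
    by (rule X_bound) blast
  let ?j = "norm (jmat :: complex ^ ('p + 'p) ^ ('p + 'p))"
  let ?e = "C * exp (K * l)"
  have "norm (Vt x) \<le> b + (?e * ?e * ?e + ?j * (?e * ?e) * ?e * ?j)" if "x \<in> {0..l}" for x
  proof -
    have "C * exp (K * x) \<le> ?e"
      using that CK by (intro mult_exp_mono) auto
    then have e: "norm (P x) \<le> ?e" "norm (Si x) \<le> ?e"
      using b[of x] that by auto
    have X: "norm (X x) \<le> ?e * ?e"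
      unfolding X_def by (intro norm_mat_mult_le) (simp_all add: e)
    have "norm (X x ** P x - jmat ** X x ** P x ** jmat) \<le> ?e * ?e * ?e + ?j * (?e * ?e) * ?e * ?j"
      by (rule order_trans[OF norm_triangle_ineq4]) (intro add_mono norm_mat_mult_le e X order_refl)
    then show ?thesis
      unfolding Vt_def using V_bound[of x] that by (intro norm_triangle_le add_mono) auto
  qed
  then show ?thesis unfolding bounded_iff by blast
qed

lemma Wt_solution:
  assumes "norm A < Im z" "cmod a < Im z"
  shows "normalised_fundamental_solution Vt z (\<lambda>x. Wt x z)"
  unfolding normalised_fundamental_solution_def
proof (intro conjI allI impI)
  show "Wt 0 z = mat 1"
    using assms by (simp add: Wt_def W0_0 w_w')
  fix x :: real assume "x \<ge> 0"
  show "((\<lambda>x. Wt x z) has_vector_derivative ((\<i> * z) *\<^sub>C jmat + jmat ** Vt x) ** Wt x z) (at x within {0..})"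
    unfolding Wt_def
    by (rule has_vector_derivative_eq_rhs[OF mat_mult_has_vector_derivative[OF mat_mult_has_vector_derivative[OF
              w_deriv[OF \<open>x \<ge> 0\<close> assms(1)] W0_deriv[OF assms(2)]] has_vector_derivative_const]])
      (simp add: Vt_def mat_distribs)
qed

lemma dirac_W_Vt: "\<lbrakk>norm A < Im z; cmod a < Im z; x \<ge> 0\<rbrakk> \<Longrightarrow> dirac_W Vt x z = Wt x z"
  by (rule dirac_W_eq[OF Vt_bounded Wt_solution])

lemma norm_L: "norm (L x z) \<le> 2 * norm (mat 1 :: complex ^ 'p ^ 'p)" if "cmod a < Im z"
proof -
  have "cmod (h z) / cmod a \<le> 1"
    using cmod_h[OF that] a_nz by simp
  then have "cmod (h z) / cmod a * norm (mat 1 :: complex ^ 'p ^ 'p) \<le> 1 * norm (mat 1 :: complex ^ 'p ^ 'p)"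
    by (rule mult_right_mono) simp
  then show ?thesis
    unfolding L_def by (intro order_trans[OF norm_hcat]) (simp add: norm_mult norm_divide ec_inverse(3))
qed

text \<open>Multiplication by L w' from the left undoes \<open>w\<close>, and L absorbs
  \<open>W0\<close> into the scalar e^(-i\<zeta>x). What remains is L(0) w'(0) [0; g], a small
  perturbation of g; dividing by the norms of L and w' gives the bound.\<close>

lemma Wt_lower_bound:
  obtains M k K where "k > 0" "\<And>x z (g :: complex ^ 'p ^ 'p). \<lbrakk>x \<ge> 0; M < Im z\<rbrakk> \<Longrightarrow>
    k * norm g * exp ((Im z - K) * x) \<le> norm (Wt x z ** vcat 0 g)"
proof -
  obtain C K where C0: "C \<ge> 0" and "K \<ge> 0"
    "\<And>x z. \<lbrakk>x \<ge> 0; norm A + 1 \<le> Im z\<rbrakk> \<Longrightarrow> norm (w x z) \<le> C * exp (K * x)"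
    and w': "\<And>x z. \<lbrakk>x \<ge> 0; norm A + 1 \<le> Im z\<rbrakk> \<Longrightarrow> norm (w' x z) \<le> C * exp (K * x)"
    and w'0: "\<And>z. norm A < Im z \<Longrightarrow> norm (w' 0 z - mat 1) \<le> C / (Im z - norm A)"
    by (rule w_bounds) blast
  define N where "N = 2 * norm (mat 1 :: complex ^ 'p ^ 'p) + 1"
  have N: "N \<ge> 1" by (simp add: N_def)
  \<comment> \<open>The summand 2NC makes the perturbation of g at most half of its norm; the others
    make the resolvent bounds and the branch of \<zeta> available.\<close>
  define M where "M = norm A + 1 + 2 * N * C + cmod a"
  \<comment> \<open>The 2 is the lost half of g, N bounds L, and C + 1 in place of C keeps the
    denominator positive.\<close>
  define k where "k = 1 / (2 * N * (C + 1))"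
  show ?thesis
  proof
    show k: "k > 0" using N C0 by (simp add: k_def)
    fix x :: real and z and g :: "complex ^ 'p ^ 'p"
    assume x: "x \<ge> 0" and "M < Im z"
    then have z: "norm A + 1 + 2 * N * C + cmod a < Im z" by (simp add: M_def)
    then have z': "cmod a < Im z" "norm A < Im z" "norm A + 1 \<le> Im z" "2 * N * C < Im z - norm A"
      using N C0 mult_nonneg_nonneg[of N C] norm_ge_zero[of A] norm_ge_zero[of a] by linarith+
    have LN: "norm (L x z) \<le> N" for x :: real
      using norm_L[OF z'(1)] by (simp add: N_def add_increasing2)
    have g: "norm (vcat 0 g :: complex ^ 'p ^ ('p + 'p)) \<le> norm g"
      using norm_vcat[of 0 g] by simp
    have "L 0 z ** w' 0 z ** vcat 0 g = g + L 0 z ** (w' 0 z - mat 1) ** vcat 0 g"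
      by (simp add: mat_distribs) (simp add: L_def block_simps ec_def)
    moreover have "norm (L 0 z ** (w' 0 z - mat 1) ** vcat 0 g) \<le> norm g / 2"
    proof -
      have "norm (L 0 z ** (w' 0 z - mat 1) ** vcat 0 g) \<le> N * (C / (Im z - norm A)) * norm g"
        by (intro norm_mat_mult_le LN w'0 z' g)
      also have "N * (C / (Im z - norm A)) \<le> 1 / 2"
        using z' by (simp add: field_simps)
      finally show ?thesis by (simp add: mult_right_mono)
    qed
    ultimately have half: "norm g / 2 \<le> norm (L 0 z ** w' 0 z ** vcat 0 g)"
      by (smt (verit) field_sum_of_halves norm_triangle_ineq4 add_diff_cancel_right')
    have "L x z ** w' x z ** (Wt x z ** vcat 0 g) = L x z ** (w' x z ** w x z) ** W0 x z ** w' 0 z ** vcat 0 g"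
      by (simp add: Wt_def matrix_mul_assoc)
    also have "\<dots> = exp (- \<i> * \<zeta> z * of_real x) *\<^sub>C (L 0 z ** w' 0 z ** vcat 0 g)"
      using x z' by (simp add: w'_w L_W0)
    finally have "norm (L x z ** w' x z ** (Wt x z ** vcat 0 g)) = exp (Im (\<zeta> z) * x) * norm (L 0 z ** w' 0 z ** vcat 0 g)"
      by simp
    moreover have "norm (L x z ** w' x z ** (Wt x z ** vcat 0 g)) \<le> N * (C * exp (K * x)) * norm (Wt x z ** vcat 0 g)"
      by (intro norm_mat_mult_le LN w' z' x order_refl)
    moreover have "exp ((Im z - cmod a) * x) * (norm g / 2) \<le> exp (Im (\<zeta> z) * x) * norm (L 0 z ** w' 0 z ** vcat 0 g)"
      using half x Im_zeta[OF z'(1)] by (intro mult_mono) (auto intro!: mult_right_mono)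
    ultimately have "exp ((Im z - cmod a) * x) * (norm g / 2) \<le> N * (C * exp (K * x)) * norm (Wt x z ** vcat 0 g)"
      by linarith
    also have "\<dots> \<le> N * ((C + 1) * exp (K * x)) * norm (Wt x z ** vcat 0 g)"
      using N C0 by (intro mult_right_mono mult_left_mono) auto
    also have "exp ((Im z - cmod a) * x) * (norm g / 2) = exp ((Im z - (cmod a + K)) * x) * norm g / 2 * exp (K * x)"
      by (simp add: mult_ac flip: exp_add) (simp add: algebra_simps flip: exp_add)
    finally have "(exp ((Im z - (cmod a + K)) * x) * norm g / 2) * exp (K * x) \<le>
        (N * (C + 1) * norm (Wt x z ** vcat 0 g)) * exp (K * x)"
      by (simp only: mult_ac)
    then have "exp ((Im z - (cmod a + K)) * x) * norm g / 2 \<le> N * (C + 1) * norm (Wt x z ** vcat 0 g)"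
      by (rule mult_right_le_imp_le) simp
    then have "norm g * exp ((Im z - (cmod a + K)) * x) \<le> norm (Wt x z ** vcat 0 g) * (2 * N * (C + 1))"
      by (simp add: mult.assoc mult.left_commute mult.commute del: distrib_left_numeral distrib_right_numeral)
    moreover have "0 < 2 * N * (C + 1)" using N C0 by simp
    ultimately have "norm g * exp ((Im z - (cmod a + K)) * x) / (2 * N * (C + 1)) \<le> norm (Wt x z ** vcat 0 g)"
      by (simp only: pos_divide_le_eq)
    then show "k * norm g * exp ((Im z - (cmod a + K)) * x) \<le> norm (Wt x z ** vcat 0 g)"
      by (simp add: k_def)
  qed
qed

text \<open>The root s in \<open>zeta_branch\<close> has Re s = Im \<zeta> > 0, whereas a root of a
  nonpositive real number is imaginary; so the radicand avoids the cut of
  \<open>csqrt\<close>.\<close>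

lemma zeta_holomorphic: "\<zeta> holomorphic_on half_plane (cmod a)"
  unfolding zeta_branch_def
proof (intro holomorphic_intros)
  fix z assume "z \<in> half_plane (cmod a)"
  then have pos: "Im (\<zeta> z) > 0"
    by (intro Im_zeta_pos) (simp add: half_plane_def)
  define s where "s = csqrt (- ((z - of_real c)\<^sup>2 + of_real ((cmod a)\<^sup>2)))"
  have "Re s > 0" using pos by (simp add: zeta_branch_def s_def)
  show "- ((z - of_real c)\<^sup>2 + of_real ((cmod a)\<^sup>2)) \<notin> \<real>\<^sub>\<le>\<^sub>0"
  proof
    assume "- ((z - of_real c)\<^sup>2 + of_real ((cmod a)\<^sup>2)) \<in> \<real>\<^sub>\<le>\<^sub>0"
    then have "s\<^sup>2 \<in> \<real>\<^sub>\<le>\<^sub>0" by (simp add: s_def)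
    then have "Re s * Im s = 0" "(Re s)\<^sup>2 \<le> (Im s)\<^sup>2"
      by (auto simp: complex_nonpos_Reals_iff Re_power2 Im_power2)
    then show False using \<open>Re s > 0\<close> by simp
  qed
qed

section \<open>The explicit Weyl function\<close>

definition "C1 = (1 / a) *\<^sub>C (cadjoint L1 ** Si 0)"
definition "C2 = \<i> *\<^sub>C (cadjoint L2 ** Si 0)"
definition "B z = (\<i> * a) *\<^sub>C L1 + h z *\<^sub>C L2"
definition "Rx z = matrix_inv (A - B z ** C1 - z *\<^sub>C mat 1)"
definition "\<phi> z = (1 / (\<i> * a)) *\<^sub>C (h z *\<^sub>C mat 1 + (h z *\<^sub>C mat 1 ** C1 - C2) ** Rx z ** B z)"
definition "T z = mat 1 + C1 ** Rx z ** B z"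
definition "NB = cmod a * norm L1 + cmod a * norm L2"
text \<open>The matrix inverted in \<open>Rx\<close> varies with z through h, so no fixed spectrum
  can be avoided. Its norm stays below norm A + NB * norm C1, since |h| \<le> |a|; beyond this
  threshold z clears that bound by at least 1.\<close>

definition "M1 = norm A + NB * norm C1 + cmod a + 1"

lemma M1_less: "norm A + 1 \<le> M1" "norm A < M1" "cmod a < M1" "norm A + NB * norm C1 + 1 \<le> M1"
proof -
  have "0 \<le> NB * norm C1" by (simp add: NB_def)
  then show "norm A + 1 \<le> M1" "norm A < M1" "cmod a < M1" "norm A + NB * norm C1 + 1 \<le> M1"
    using norm_ge_zero[of A] norm_ge_zero[of a] unfolding M1_def by linarith+
qed

lemma norm_B: "norm (B z) \<le> NB" if "M1 < Im z"
proof -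
  have "cmod (h z) \<le> cmod a" using that M1_less by (intro cmod_h) simp
  then have "cmod (h z) * norm L2 \<le> cmod a * norm L2" by (rule mult_right_mono) simp
  then show ?thesis
    unfolding B_def NB_def by (intro norm_triangle_le) (simp add: norm_mult)
qed

lemma Rx:
  assumes "M1 < Im z"
  shows "(A - B z ** C1 - z *\<^sub>C mat 1) ** Rx z = mat 1"
    and "norm (Rx z) \<le> norm (mat 1 :: complex ^ 'n ^ 'n)"
proof -
  have "norm (A - B z ** C1) \<le> norm A + NB * norm C1"
    by (rule order_trans[OF norm_triangle_ineq4]) (intro add_mono norm_mat_mult_le norm_B assms order_refl)
  then have le: "norm (A - B z ** C1) + 1 \<le> cmod z"
    using M1_less(4) assms abs_Im_le_cmod[of z] by linarith
  show "(A - B z ** C1 - z *\<^sub>C mat 1) ** Rx z = mat 1"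
    and "norm (Rx z) \<le> norm (mat 1 :: complex ^ 'n ^ 'n)"
    unfolding Rx_def using mat_inv_diff_scalar[OF le] by simp_all
qed

text \<open>The state-space inversion formula: \<open>T\<close> is the inverse of \<open>I - C1 (A - z)\<^sup>-\<^sup>1 B\<close>, the upper block of \<open>w [I; \<phi>0]\<close> at 0.\<close>

lemma w_phi0: "w 0 z ** (vcat (mat 1) (\<phi>0 z *\<^sub>C mat 1) ** T z) = vcat (mat 1) (\<phi> z)" if z: "M1 < Im z"
proof -
  have zA: "norm A < Im z" using z M1_less by linarith
  have "A ** (Rx z ** B z) = B z + B z ** (C1 ** (Rx z ** B z)) + z *\<^sub>C (Rx z ** B z)"
    using arg_cong[OF Rx(1)[OF z], of "\<lambda>M. M ** B z"] by (simp add: mat_distribs algebra_simps)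
  then have "Res z ** (A ** (Rx z ** B z)) = Res z ** (B z + B z ** (C1 ** (Rx z ** B z)) + z *\<^sub>C (Rx z ** B z))"
    by simp
  \<comment> \<open>The resolvent of A disappears here: \<open>T\<close> trades it for
    \<open>Rx\<close>, the only resolvent in \<phi>.\<close>
  then have RBT: "Res z ** (B z ** T z) = Rx z ** B z"
    by (simp add: T_def mat_distribs resolvent_mult(2)[OF zA])
  have P: "P 0 ** (vcat (mat 1) (\<phi>0 z *\<^sub>C mat 1) ** T z) = (1 / (\<i> * a)) *\<^sub>C (B z ** T z)"
    using a_nz unfolding matrix_mul_assoc by (simp add: P_0 hcat_mult_vcat B_def \<phi>0_def smult_mat_add mat_mult_add)
  have X: "X 0 ** N = vcat (a *\<^sub>C (C1 ** N)) (- (\<i> *\<^sub>C (C2 ** N)))" for N :: "complex ^ 'p ^ 'n"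
    using a_nz by (simp add: X_def P_0 block_simps C1_def C2_def mat_mult_assoc)
  have "w 0 z ** (vcat (mat 1) (\<phi>0 z *\<^sub>C mat 1) ** T z) =
      vcat (T z) (\<phi>0 z *\<^sub>C T z) - \<i> *\<^sub>C ((1 / (\<i> * a)) *\<^sub>C (X 0 ** (Rx z ** B z)))"
    by (simp add: w_def mat_mult_diff mat_mult_assoc P RBT) (simp add: vcat_mult)
  moreover have "\<i> / a = - (1 / (\<i> * a))"
    using a_nz by (simp add: field_simps)
  then have "vcat (T z) (\<phi>0 z *\<^sub>C T z) - \<i> *\<^sub>C ((1 / (\<i> * a)) *\<^sub>C (X 0 ** (Rx z ** B z))) = vcat (mat 1) (\<phi> z)"
    unfolding X using a_nz by (simp add: block_simps T_def \<phi>_def \<phi>0_def mat_distribs add_diff_eq)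
  ultimately show ?thesis by simp
qed

lemma norm_T: "norm (T z) \<le> norm (mat 1 :: complex ^ 'p ^ 'p) + norm C1 * norm (mat 1 :: complex ^ 'n ^ 'n) * NB" if "M1 < Im z"
  unfolding T_def by (intro norm_triangle_le add_mono norm_mat_mult_le order_refl Rx norm_B that)

text \<open>By \<open>w_phi0\<close> the initial value is w(0) [I; \<phi>0] T. The factor w'(0) in
  \<open>Wt\<close> cancels w(0), so \<open>W0\<close> acts on its decaying direction, and w and T
  cost only factors bounded uniformly in z up to e^(Kx).\<close>

lemma Wt_upper_bound:
  obtains C K where "\<And>x z. \<lbrakk>x \<ge> 0; M1 < Im z\<rbrakk> \<Longrightarrow>
    norm (Wt x z ** vcat (mat 1) (\<phi> z)) \<le> C * exp ((K - Im z) * x)"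
proof -
  obtain C K where C: "C \<ge> 0" and "K \<ge> 0"
    and w: "\<And>x z. \<lbrakk>x \<ge> 0; norm A + 1 \<le> Im z\<rbrakk> \<Longrightarrow> norm (w x z) \<le> C * exp (K * x)"
    by (rule w_bounds) blast
  define N where "N = norm (mat 1 :: complex ^ 'p ^ 'p)"
  define NT where "NT = N + norm C1 * norm (mat 1 :: complex ^ 'n ^ 'n) * NB"
  have N: "N \<ge> 0" "NT \<ge> 0" by (auto simp: N_def NT_def NB_def)
  have "norm (Wt x z ** vcat (mat 1) (\<phi> z)) \<le> (C * (2 * N) * NT) * exp ((K + cmod a - Im z) * x)"
    if x: "x \<ge> 0" and z: "M1 < Im z" for x z
  proof -
    have z': "norm A + 1 \<le> Im z" "norm A < Im z" "cmod a < Im z" using z M1_less by linarith+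
    let ?v = "vcat (ec x *\<^sub>C mat 1) ((\<phi>0 z / ec x) *\<^sub>C mat 1) :: complex ^ 'p ^ ('p + 'p)"
    have "cmod (\<phi>0 z) \<le> 1"
      using cmod_h[OF z'(3)] a_nz by (simp add: \<phi>0_def norm_divide norm_mult)
    then have "cmod (\<phi>0 z) * N \<le> 1 * N" by (rule mult_right_mono) (rule N)
    then have v: "norm ?v \<le> 2 * N"
      by (intro order_trans[OF norm_vcat]) (simp add: norm_divide ec_inverse(3) N_def)
    have "Wt x z ** vcat (mat 1) (\<phi> z) =
        w x z ** (W0 x z ** ((w' 0 z ** w 0 z) ** (vcat (mat 1) (\<phi>0 z *\<^sub>C mat 1) ** T z)))"
      by (simp only: Wt_def w_phi0[OF z, symmetric] mat_mult_assoc)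
    also have "\<dots> = w x z ** (W0 x z ** vcat (mat 1) (\<phi>0 z *\<^sub>C mat 1) ** T z)"
      using z' by (simp add: w'_w mat_mult_assoc)
    also have "\<dots> = exp (\<i> * \<zeta> z * of_real x) *\<^sub>C (w x z ** (?v ** T z))"
      by (simp add: W0_decaying[OF z'(3)])
    finally have "norm (Wt x z ** vcat (mat 1) (\<phi> z)) = exp (- Im (\<zeta> z) * x) * norm (w x z ** (?v ** T z))"
      by simp
    also have "\<dots> \<le> exp ((cmod a - Im z) * x) * (C * exp (K * x) * (2 * N * NT))"
    proof (intro mult_mono norm_mat_mult_le w x z' v)
      show "exp (- Im (\<zeta> z) * x) \<le> exp ((cmod a - Im z) * x)"
        using mult_right_mono[OF Im_zeta[OF z'(3)] x] by (simp add: algebra_simps)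
      show "norm (T z) \<le> NT" unfolding NT_def N_def by (rule norm_T[OF z])
    qed simp_all
    also have "\<dots> = (C * (2 * N) * NT) * exp ((K + cmod a - Im z) * x)"
      by (simp add: mult_ac flip: exp_add) (simp add: algebra_simps)
    finally show ?thesis .
  qed
  then show ?thesis by (rule that)
qed

lemma phi_holomorphic: "matrix_holomorphic_on \<phi> (half_plane M1)"
proof -
  have h: "h holomorphic_on half_plane M1"
    unfolding h_def[abs_def]
    by (intro holomorphic_intros holomorphic_on_subset[OF zeta_holomorphic])
      (use M1_less(3) in \<open>auto simp: half_plane_def\<close>)
  have B: "matrix_holomorphic_on B (half_plane M1)"
    unfolding B_def[abs_def]
    by (intro matrix_holomorphic_add matrix_holomorphic_smult matrix_holomorphic_const h holomorphic_intros)
  have R: "matrix_holomorphic_on Rx (half_plane M1)"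
    unfolding Rx_def[abs_def]
    by (rule matrix_holomorphic_inv, intro matrix_holomorphic_diff matrix_holomorphic_mult matrix_holomorphic_smult
        matrix_holomorphic_const B holomorphic_intros)
      (use Rx(1) in \<open>auto simp: half_plane_def Rx_def\<close>)
  show ?thesis
    unfolding \<phi>_def[abs_def]
    by (intro matrix_holomorphic_add matrix_holomorphic_diff matrix_holomorphic_mult matrix_holomorphic_smult
        matrix_holomorphic_const B R h holomorphic_intros)
qed

theorem weyl_GW_phi: "weyl_function Vt \<phi> \<and> GW_function Vt \<phi> \<and>
    (\<forall>\<psi>. weyl_function Vt \<psi> \<or> GW_function Vt \<psi> \<longrightarrow> (\<exists>M>0. \<forall>z\<in>half_plane M. \<psi> z = \<phi> z))"
proof -
  obtain C K where upper: "\<And>x z. \<lbrakk>x \<ge> 0; M1 < Im z\<rbrakk> \<Longrightarrow>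
      norm (Wt x z ** vcat (mat 1) (\<phi> z)) \<le> C * exp ((K - Im z) * x)"
    by (rule Wt_upper_bound) blast
  obtain M k K' where k: "k > 0" and lower: "\<And>x z (g :: complex ^ 'p ^ 'p). \<lbrakk>x \<ge> 0; M < Im z\<rbrakk> \<Longrightarrow>
      k * norm g * exp ((Im z - K') * x) \<le> norm (Wt x z ** vcat 0 g)"
    by (rule Wt_lower_bound) blast
  define M' where "M' = max M M1"
  have M': "M \<le> M'" "M1 \<le> M'" by (auto simp: M'_def)
  have C: "0 \<le> C"
    using order_trans[OF norm_ge_zero upper[of 0 "\<i> * of_real (M1 + 1)"]] by simp
  have W: "dirac_W Vt x z = Wt x z" if "x \<ge> 0" "M' < Im z" for x z
    using that M' M1_less by (intro dirac_W_Vt) auto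
  show ?thesis
  \<comment> \<open>One rate has to serve both estimates; enlarging it weakens each of them.\<close>
  proof (rule weyl_GW_of_exponential_dichotomy[OF Vt_bounded, of _ M' C "max K K'" k])
    show "matrix_holomorphic_on \<phi> (half_plane M')"
      by (rule matrix_holomorphic_on_subset[OF phi_holomorphic]) (use M' in \<open>auto simp: half_plane_def\<close>)
    show "continuous_on {0..} (\<lambda>x. dirac_W Vt x z)" if z: "M' < Im z" for z
    proof -
      have "continuous_on {0..} (\<lambda>x. Wt x z)"
        using Wt_solution[of z] z M' M1_less unfolding normalised_fundamental_solution_def
        by (intro continuous_on_vector_derivative) auto
      moreover have "continuous_on {0..} (\<lambda>x. dirac_W Vt x z) \<longleftrightarrow> continuous_on {0..} (\<lambda>x. Wt x z)"
        by (rule continuous_on_cong) (use W z in auto)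
      ultimately show ?thesis by simp
    qed
    show "norm (dirac_W Vt x z ** vcat (mat 1) (\<phi> z)) \<le> C * exp ((max K K' - Im z) * x)"
      if "0 \<le> x" "M' < Im z" for x z
    proof -
      have "C * exp ((K - Im z) * x) \<le> C * exp ((max K K' - Im z) * x)"
        using that C by (intro mult_left_mono) (auto intro!: mult_right_mono)
      then show ?thesis using upper[of x z] that M' by (simp add: W)
    qed
    show "k * norm g * exp ((Im z - max K K') * x) \<le> norm (dirac_W Vt x z ** vcat 0 g)"
      if "0 \<le> x" "M' < Im z" for x z and g :: "complex ^ 'p ^ 'p"
    proof -
      have "k * norm g * exp ((Im z - max K K') * x) \<le> k * norm g * exp ((Im z - K') * x)"
        using that k by (intro mult_left_mono) (auto intro!: mult_right_mono)
      then show ?thesis using lower[of x z g] that M' by (simp add: W)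
    qed
  qed (rule k)
qed

end

section \<open>The Weyl function\<close>

theorem theorem5p8:
  fixes a :: complex and c :: real
    and A Q :: "complex ^ 'n ^ 'n"
    and f1 f2 f3 f4 :: "complex ^ 'p ^ 'n"
    and v vt :: "real \<Rightarrow> complex ^ 'p ^ 'p"
    and \<Lambda>1 \<Lambda>2 :: "real \<Rightarrow> complex ^ 'p ^ 'n"
    and P :: "real \<Rightarrow> complex ^ ('p + 'p) ^ 'n"
    and S :: "real \<Rightarrow> complex ^ 'n ^ 'n"
    and Vt :: "real \<Rightarrow> complex ^ ('p + 'p) ^ ('p + 'p)"
    and h :: "complex \<Rightarrow> complex"
    and \<D> :: "complex \<Rightarrow> complex ^ 'p ^ 'p"
    and \<C>1 \<C>2 :: "complex ^ 'n ^ 'p"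
    and \<B> :: "complex \<Rightarrow> complex ^ 'p ^ 'n"
    and Ax :: "complex \<Rightarrow> complex ^ 'n ^ 'n"
    and \<phi> :: "complex \<Rightarrow> complex ^ 'p ^ 'p"
  assumes a: "a \<noteq> 0"
    and v: "\<And>x. v x = (a * exp (2 * \<i> * of_real c * of_real x)) *\<^sub>C mat 1"
    and det: "det ((A - of_real c *\<^sub>C mat 1) ** (A - of_real c *\<^sub>C mat 1)
                    + of_real ((cmod a)\<^sup>2) *\<^sub>C mat 1) \<noteq> 0"
    and AQ: "A ** Q = Q ** A"
    and QQ: "Q ** Q = (A - of_real c *\<^sub>C mat 1) ** (A - of_real c *\<^sub>C mat 1)
                    + of_real ((cmod a)\<^sup>2) *\<^sub>C mat 1"
    and f3: "f3 = (\<i> / cnj a) *\<^sub>C ((Q + A - of_real c *\<^sub>C mat 1) ** f1)"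
    and f4: "f4 = - ((\<i> / cnj a) *\<^sub>C ((Q - A + of_real c *\<^sub>C mat 1) ** f2))"
    and \<Lambda>1: "\<And>x. \<Lambda>1 x = exp (- \<i> * of_real c * of_real x) *\<^sub>C
                  (mexp ((\<i> * of_real x) *\<^sub>C Q) ** f1 + mexp (- ((\<i> * of_real x) *\<^sub>C Q)) ** f2)"
    and \<Lambda>2: "\<And>x. \<Lambda>2 x = exp (\<i> * of_real c * of_real x) *\<^sub>C
                  (mexp ((\<i> * of_real x) *\<^sub>C Q) ** f3 + mexp (- ((\<i> * of_real x) *\<^sub>C Q)) ** f4)"
    and P: "\<And>x. P x = hcat (\<Lambda>1 x) (\<Lambda>2 x)"
    and S0: "A ** S 0 - S 0 ** cadjoint A = \<i> *\<^sub>C (P 0 ** cadjoint (P 0))"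
    and S: "\<And>x. x \<ge> 0 \<Longrightarrow> S x = S 0 + integral {0..x} (\<lambda>r. P r ** jmat ** cadjoint (P r))"
    and S0_pos: "posdef (S 0)"
    and vt: "\<And>x. vt x = v x + 2 *\<^sub>C (cadjoint (\<Lambda>1 x) ** matrix_inv (S x) ** \<Lambda>2 x)"
    and Vt: "\<And>x. Vt x = vcat (hcat 0 (vt x)) (hcat (cadjoint (vt x)) 0)"
    and h: "\<And>z. h z = z - of_real c - zeta_branch a c z"
    and D: "\<And>z. \<D> z = h z *\<^sub>C mat 1"
    and C1: "\<C>1 = (1 / a) *\<^sub>C (cadjoint (\<Lambda>1 0) ** matrix_inv (S 0))"
    and C2: "\<C>2 = \<i> *\<^sub>C (cadjoint (\<Lambda>2 0) ** matrix_inv (S 0))"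
    and B: "\<And>z. \<B> z = (\<i> * a) *\<^sub>C \<Lambda>1 0 + h z *\<^sub>C \<Lambda>2 0"
    and Ax: "\<And>z. Ax z = A - \<B> z ** \<C>1"
    and \<phi>: "\<And>z. \<phi> z = (1 / (\<i> * a)) *\<^sub>C
                  (\<D> z + (\<D> z ** \<C>1 - \<C>2) ** matrix_inv (Ax z - z *\<^sub>C mat 1) ** \<B> z)"
  shows "weyl_function Vt \<phi> \<and> GW_function Vt \<phi> \<and>
    (\<forall>\<psi>. weyl_function Vt \<psi> \<or> GW_function Vt \<psi> \<longrightarrow> (\<exists>M>0. \<forall>z\<in>half_plane M. \<psi> z = \<phi> z))"
proof -
  let ?V = "\<lambda>x. blk 0 (a * exp (2 * \<i> * of_real c * of_real x)) (cnj a * exp (- (2 * \<i> * of_real c * of_real x))) 0 :: complex ^ ('p + 'p) ^ ('p + 'p)"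
  let ?b = "2 * cmod a * norm (mat 1 :: complex ^ 'p ^ 'p)"
  define E where "E x = mexp ((\<i> * of_real x) *\<^sub>C Q)" for x
  define E' where "E' x = mexp (- ((\<i> * of_real x) *\<^sub>C Q))" for x
  define e where "e x = exp (\<i> * of_real c * of_real x)" for x
  have E'_eq: "E' x = mexp ((- \<i> * of_real x) *\<^sub>C Q)" for x
    by (simp add: E'_def)
  have e_inv: "exp (- \<i> * of_real c * of_real x) = 1 / e x" "e x \<noteq> 0" for x
    by (simp_all add: e_def exp_minus field_simps)
  have e_sq: "exp (2 * \<i> * of_real c * of_real x) = (e x)\<^sup>2" "exp (- (2 * \<i> * of_real c * of_real x)) = (1 / e x)\<^sup>2" for x
    unfolding e_inv(1)[symmetric] unfolding e_def exp_double[symmetric] by (simp_all add: mult.assoc)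
  have QA: "Q ** A = A ** Q" using AQ by simp
  have comm: "A ** (E x ** M) = E x ** (A ** M)" "Q ** (E x ** M) = E x ** (Q ** M)"
    "A ** (E' x ** M) = E' x ** (A ** M)" "Q ** (E' x ** M) = E' x ** (Q ** M)" if "x \<ge> 0" for x and M :: "complex ^ 'p ^ 'n"
    using mexp_commute[OF AQ that, of "\<i>"] mexp_commute[OF refl that, of Q "\<i>"]
      mexp_commute[OF AQ that, of "- \<i>"] mexp_commute[OF refl that, of Q "- \<i>"]
    unfolding matrix_mul_assoc E_def E'_eq by simp_all
  have E_deriv: "(E has_vector_derivative \<i> *\<^sub>C (Q ** E x)) (at x within T)" for x T
    using mexp_has_vector_derivative[of "\<i>" 0 Q] by (simp add: E_def[abs_def])
  have E'_deriv: "(E' has_vector_derivative - (\<i> *\<^sub>C (Q ** E' x))) (at x within T)" for x T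
    using mexp_has_vector_derivative[of "- \<i>" 0 Q] by (simp add: E'_def[abs_def])
  have e_deriv: "(e has_vector_derivative \<i> * of_real c * e x) (at x within T)"
    "((\<lambda>x. 1 / e x) has_vector_derivative - (\<i> * of_real c * (1 / e x))) (at x within T)" for x T
    using exp_ix_deriv[of "\<i> * of_real c" x T] exp_ix_deriv[of "- \<i> * of_real c" x T]
    unfolding e_inv(1)[symmetric] by (simp_all add: e_def[abs_def])
  have QQ': "Q ** (Q ** M) = (A - of_real c *\<^sub>C mat 1) ** ((A - of_real c *\<^sub>C mat 1) ** M) + (a * cnj a) *\<^sub>C M"
    for M :: "complex ^ 'p ^ 'n"
    unfolding matrix_mul_assoc QQ by (simp only: complex_norm_square) (simp add: mat_mult_add)
  \<comment> \<open>These are the equation for \<Lambda>1: comparing coefficients of the two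
    exponentials determines f3 and f4.\<close>
  have f3': "cnj a *\<^sub>C f3 = \<i> *\<^sub>C ((Q + A - of_real c *\<^sub>C mat 1) ** f1)"
    and f4': "cnj a *\<^sub>C f4 = - (\<i> *\<^sub>C ((Q - A + of_real c *\<^sub>C mat 1) ** f2))"
    using a by (simp_all add: f3 f4)
  have Q_A_mult: "Q ** (A ** M) = A ** (Q ** M)" for M :: "complex ^ 'p ^ 'n"
    by (simp add: matrix_mul_assoc AQ)
  \<comment> \<open>The equation for \<Lambda>2 needs the quadratic relation: as Q commutes with A,
    the product is Q^2 - (A - c)^2, that is |a|^2.\<close>
  have "(Q - A + of_real c *\<^sub>C mat 1) ** ((Q + A - of_real c *\<^sub>C mat 1) ** f1) = (a * cnj a) *\<^sub>C f1"
    by (simp add: mat_distribs QQ' Q_A_mult)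
  from arg_cong[OF this, of "\<lambda>M. (- 1 / cnj a) *\<^sub>C M"]
  have g3: "\<i> *\<^sub>C (Q ** f3) = \<i> *\<^sub>C (A ** f3) - (\<i> * of_real c) *\<^sub>C f3 - a *\<^sub>C f1"
    using a by (simp add: f3 mat_distribs Q_A_mult two_mult algebra_simps)
  have "(Q + A - of_real c *\<^sub>C mat 1) ** ((Q - A + of_real c *\<^sub>C mat 1) ** f2) = (a * cnj a) *\<^sub>C f2"
    by (simp add: mat_distribs QQ' Q_A_mult)
  from arg_cong[OF this, of "\<lambda>M. (- 1 / cnj a) *\<^sub>C M"]
  have g4: "\<i> *\<^sub>C (Q ** f4) = (\<i> * of_real c) *\<^sub>C f4 - \<i> *\<^sub>C (A ** f4) + a *\<^sub>C f2"
    using a by (simp add: f4 mat_distribs Q_A_mult two_mult algebra_simps)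
  have \<Lambda>1': "\<Lambda>1 = (\<lambda>x. (1 / e x) *\<^sub>C (E x ** f1 + E' x ** f2))"
    by (rule ext) (simp only: \<Lambda>1 e_inv(1) E_def E'_def)
  have \<Lambda>2': "\<Lambda>2 = (\<lambda>x. e x *\<^sub>C (E x ** f3 + E' x ** f4))"
    by (rule ext) (simp only: \<Lambda>2 e_def E_def E'_def)
  have \<Lambda>1_deriv: "(\<Lambda>1 has_vector_derivative - (\<i> *\<^sub>C (A ** \<Lambda>1 x)) + (cnj a * (1 / e x)\<^sup>2) *\<^sub>C \<Lambda>2 x) (at x within T)"
    if x: "x \<ge> 0" for x T
  proof -
    have "(cnj a * (1 / e x)\<^sup>2) *\<^sub>C \<Lambda>2 x = (1 / e x) *\<^sub>C (E x ** (cnj a *\<^sub>C f3) + E' x ** (cnj a *\<^sub>C f4))"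
      using e_inv(2)[of x] by (simp add: \<Lambda>2' power2_eq_square smult_mat_add mult_ac)
    then show ?thesis
      unfolding \<Lambda>1' f3' f4'
      by (intro has_vector_derivative_eq_rhs[OF smult_mat_has_vector_derivative[OF e_deriv(2)
              has_vector_derivative_add[OF mat_mult_has_vector_derivative[OF E_deriv has_vector_derivative_const]
                mat_mult_has_vector_derivative[OF E'_deriv has_vector_derivative_const]]]])
        (simp add: mat_distribs comm[OF x] algebra_simps)
  qed
  have \<Lambda>2_deriv: "(\<Lambda>2 has_vector_derivative \<i> *\<^sub>C (A ** \<Lambda>2 x) - (a * (e x)\<^sup>2) *\<^sub>C \<Lambda>1 x) (at x within T)"
    if x: "x \<ge> 0" for x T
  proof -
    have "(a * (e x)\<^sup>2) *\<^sub>C \<Lambda>1 x = e x *\<^sub>C (E x ** (a *\<^sub>C f1) + E' x ** (a *\<^sub>C f2))"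
      using e_inv(2)[of x] by (simp add: \<Lambda>1' power2_eq_square smult_mat_add mult_ac)
    moreover have "\<i> *\<^sub>C (Q ** (E x ** f3)) = E x ** (\<i> *\<^sub>C (Q ** f3))" "\<i> *\<^sub>C (Q ** (E' x ** f4)) = E' x ** (\<i> *\<^sub>C (Q ** f4))"
      by (simp_all add: comm[OF x])
    ultimately show ?thesis
      unfolding \<Lambda>2'
      by (intro has_vector_derivative_eq_rhs[OF smult_mat_has_vector_derivative[OF e_deriv(1)
              has_vector_derivative_add[OF mat_mult_has_vector_derivative[OF E_deriv has_vector_derivative_const]
                mat_mult_has_vector_derivative[OF E'_deriv has_vector_derivative_const]]]])
        (simp add: smult_mat_add smult_mat_diff mat_mult_assoc g3 g4, simp add: mat_distribs comm[OF x] algebra_simps)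
  qed
  have P_deriv: "(P has_vector_derivative - (\<i> *\<^sub>C (A ** P x ** jmat)) - P x ** jmat ** ?V x) (at x within T)"
    if "x \<ge> 0" for x T
    unfolding P[abs_def]
    by (rule has_vector_derivative_eq_rhs[OF hcat_has_vector_derivative[OF \<Lambda>1_deriv[OF that] \<Lambda>2_deriv[OF that]]])
      (simp add: e_sq blk_def jmat_def block_simps)
  have P_cont: "continuous_on {0..} P"
    by (rule continuous_on_vector_derivative[OF P_deriv]) simp
  have PjP_cont: "continuous_on {0..} (\<lambda>r. P r ** jmat ** cadjoint (P r))"
    by (intro bounded_bilinear.continuous_on[OF bounded_bilinear_mat_mult]
        bounded_linear.continuous_on[OF bounded_linear_cadjoint] P_cont continuous_on_const)
  interpret seed: exponential_seed A P S ?V ?b a c "\<Lambda>1 0" "\<Lambda>2 0"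
  proof
    show "(S has_vector_derivative P x ** jmat ** cadjoint (P x)) (at x within {0..})" if "x \<ge> 0" for x
      by (rule integral_half_line_has_vector_derivative[OF PjP_cont that S])
    show "cadjoint (?V x) = ?V x" for x
      by (simp add: cadjoint_blk exp_cnj)
    show "?V x ** jmat = - (jmat ** ?V x)" for x
      by (simp add: jmat_blk blk_mult) (simp add: blk_def block_simps)
    show "norm (?V x) \<le> ?b" if "x \<ge> 0" for x
      by (rule order_trans[OF norm_blk_antidiag]) (simp add: norm_mult)
  qed (use P_deriv S0 S0_pos a P in simp_all)
  have Vt_eq: "Vt x = seed.Vt x" if "x \<ge> 0" for x
  proof -
    \<comment> \<open>This makes the lower left block of the transformed potential the adjoint of
      the upper right one.\<close>
    have "cadjoint (matrix_inv (S x)) = matrix_inv (S x)"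
      by (rule seed.Si_herm[OF that])
    then show ?thesis
      unfolding Vt vt v seed.Vt_def seed.X_def P
      by (simp add: blk_def jmat_def block_simps cadjoint_add cadjoint_smult cadjoint_mult mat_mult_assoc exp_cnj)
        (simp add: two_mult)
  qed
  have "h = seed.h" by (simp add: fun_eq_iff h seed.h_def)
  then have "\<phi> = seed.\<phi>"
    by (simp add: fun_eq_iff \<phi> D Ax B C1 C2 seed.\<phi>_def seed.Rx_def seed.B_def seed.C1_def seed.C2_def)
  then show ?thesis
    using seed.weyl_GW_phi weyl_GW_cong[of Vt seed.Vt, OF Vt_eq] by simp
qed

end
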